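(* Let $\beta\in\{1,2,4\}$, $a\in\mathbb{R}$ and $a^*=\frac34\beta^{2/3}$. If $a<a^*$, assume moreover the following convergence property: for every $\mu\in\mathcal{P}(\mathbb{R})$, the solution $(G(z,t))_{z\in\mathbb{H},t\ge0}$ of the evolution equation with initial condition $\mu$ (see context) is such that $\lim_{t\to\infty}G(z,t)$ exists for all $z\in\mathbb{H}$. Then there exists a unique analytic function $G_a$ on $\mathbb{H}$ with the following two properties: (i) $G_a$ is the Stieltjes transform of a probability measure $\mu_a$ on $\mathbb{R}$ (equivalently, $G_a$ is analytic on $\mathbb{H}$ with $G_a(\mathbb{H})\subseteq\mathbb{H}$ and $G_a(iy)\sim-1/(iy)$ as $y\to+\infty$); (ii) $G_a$ is a stationary solution of the evolution equation, i.e. there exists a constant $J\in\mathbb{C}$ such that for all $z\in\mathbb{H}$, $$\frac{\beta}{4}G_a(z)^2+(z^2-a)G_a(z)+z=J.$$ Moreover, $\mu_a$ admits a density $\rho_a$ with respect to Lebesgue measure, given explicitly in terms of the roots of the polynomial $4z^3-4az-\beta$ as follows. If $a\ge a^*$, let $\zeta_a\in\mathbb{R}$ be the minimal root of $4z^3-4az-\beta$ (all of whose roots are real) and $\gamma_\pm=-\zeta_a\pm\sqrt{2(a-\zeta_a^2)}$. Then $\rho_a$ is supported on the compact interval $[\gamma_-,\gamma_+]$, with $$\rho_a(x)=\frac{2}{\beta\pi}(x-\zeta_a)\sqrt{(x-\gamma_-)(\gamma_+-x)},\qquad x\in[\gamma_-,\gamma_+].$$ If $a<a^*$, let $\zeta_a$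 be the unique root of $4z^3-4az-\beta$ in $\mathbb{H}$, $J_a=\zeta_a-\frac1\beta(\zeta_a^2-a)^2$ and $P_a(z)=(z^2-a)^2-\beta(z-J_a)$. Then $$\rho_a(x)=\frac{2}{\beta\pi}\,\Im\left[\sqrt{P_a(x)}\right],\qquad x\in\mathbb{R},$$ $\rho_a$ has full support in $\mathbb{R}$, and as $x\to\pm\infty$, $$\rho_a(x)\sim\frac{C_a}{x^2},\qquad C_a=\frac{1}{\pi}\Im J_a>0.$$
   Context: $\mathbb{H}=\{z\in\mathbb{C}:\Im z>0\}$, and $\mathcal{P}(\mathbb{R})$ is the space of Borel probability measures on $\mathbb{R}$ with the weak topology. The Stieltjes transform of a measure $\nu$ on $\mathbb{R}$ is $G(z)=\int_{\mathbb{R}}\frac{\nu(dx)}{x-z}$, $z\in\mathbb{H}$. The complex square root is defined by $\sqrt{re^{i\theta}}=\sqrt r\,e^{i\theta/2}$ for $r\ge0$, $\theta\in[0,2\pi)$, so it takes values in $\mathbb{H}\cup[0,\infty)$. Evolution equation: for $\mu\in\mathcal{P}(\mathbb{R})$, the solution with initial condition $\mu$ is $G(z,t)=\int_{\mathbb{R}}\frac{\mu_t(dx)}{x-z}$, where $(\mu_t)_{t\ge0}$ is the unique continuous $\mathcal{P}(\mathbb{R})$-valued function with $\mu_0=\mu$ such that for all $z\in\mathbb{H}$, $t\ge0$, $$G(z,t)=G(z,0)+\int_0^t\partial_z\left[\frac{\beta}{4}G(z,s)^2+(z^2-a)G(z,s)+z\right]ds.$$ Existence and uniqueness of this solution may be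 taken as known. *)

theory Defs
  imports "HOL-Probability.Probability" "HOL-Complex_Analysis.Complex_Analysis"
begin

definition upper_half_plane :: "complex set"
  where "upper_half_plane = {z. 0 < Im z}"

definition stieltjes :: "real measure \<Rightarrow> complex \<Rightarrow> complex"
  where "stieltjes \<nu> z = (LINT x|\<nu>. 1 / (complex_of_real x - z))"

(* The branch with values in the upper half-plane or in [0, \<infinity>): unlike csqrt, which uses
   arguments in (-pi, pi], the argument Arg2pi z lies in [0, 2 pi). *)
definition upper_csqrt :: "complex \<Rightarrow> complex"
  where "upper_csqrt z = complex_of_real (sqrt (cmod z)) * cis (Arg2pi z / 2)"

(* Continuity on [0, \<infinity>) for the weak topology, i.e. the initial topology of the maps
   \<nu> \<mapsto> \<integral> f d\<nu> for f bounded and continuous. *)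
definition weakly_continuous :: "(real \<Rightarrow> real measure) \<Rightarrow> bool"
  where "weakly_continuous m \<longleftrightarrow>
    (\<forall>f :: real \<Rightarrow> real. continuous_on UNIV f \<and> bounded (range f) \<longrightarrow>
       continuous_on {0..} (\<lambda>t. LINT x|m t. f x))"

definition flux :: "real \<Rightarrow> real \<Rightarrow> (complex \<Rightarrow> complex) \<Rightarrow> complex \<Rightarrow> complex"
  where "flux \<beta> a G z =
    of_real (\<beta> / 4) * G z ^ 2 + (z ^ 2 - of_real a) * G z + z"

(* The values m t for t < 0 play no role. *)
definition evolution_solution ::
    "real \<Rightarrow> real \<Rightarrow> real measure \<Rightarrow> (real \<Rightarrow> real measure) \<Rightarrow> bool"
  where "evolution_solution \<beta> a \<mu> m \<longleftrightarrow>
    (\<forall>t\<ge>0. real_distribution (m t)) \<and> weakly_continuous m \<and> m 0 = \<mu> \<and>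
    (\<forall>z\<in>upper_half_plane. \<forall>t\<ge>0.
       ((\<lambda>s. deriv (flux \<beta> a (stieltjes (m s))) z) has_integral
          (stieltjes (m t) z - stieltjes (m 0) z)) {0..t})"

definition convergence_property :: "real \<Rightarrow> real \<Rightarrow> bool"
  where "convergence_property \<beta> a \<longleftrightarrow>
    (\<forall>\<mu> m. real_distribution \<mu> \<and> evolution_solution \<beta> a \<mu> m \<longrightarrow>
       (\<forall>z\<in>upper_half_plane. \<exists>L. ((\<lambda>t. stieltjes (m t) z) \<longlongrightarrow> L) at_top))"

definition a_star :: "real \<Rightarrow> real"
  where "a_star \<beta> = 3 / 4 * \<beta> powr (2 / 3)"

definition represents :: "real measure \<Rightarrow> (complex \<Rightarrow> complex) \<Rightarrow> bool"
  where "represents \<mu> G \<longleftrightarrow>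
    real_distribution \<mu> \<and> (\<forall>z\<in>upper_half_plane. G z = stieltjes \<mu> z)"

(* The alternative description of Stieltjes transforms of probability measures. *)
definition normalized_pick :: "(complex \<Rightarrow> complex) \<Rightarrow> bool"
  where "normalized_pick G \<longleftrightarrow>
    G analytic_on upper_half_plane \<and> G ` upper_half_plane \<subseteq> upper_half_plane \<and>
    (\<lambda>y::real. G (\<i> * of_real y)) \<sim>[at_top] (\<lambda>y. - 1 / (\<i> * of_real y))"

definition stationary :: "real \<Rightarrow> real \<Rightarrow> (complex \<Rightarrow> complex) \<Rightarrow> bool"
  where "stationary \<beta> a G \<longleftrightarrow> (\<exists>J. \<forall>z\<in>upper_half_plane. flux \<beta> a G z = J)"

definition cubic :: "real \<Rightarrow> real \<Rightarrow> complex \<Rightarrow> complex"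
  where "cubic \<beta> a z = 4 * z ^ 3 - 4 * of_real a * z - of_real \<beta>"

definition has_density :: "real measure \<Rightarrow> (real \<Rightarrow> real) \<Rightarrow> bool"
  where "has_density \<mu> \<rho> \<longleftrightarrow>
    \<rho> \<in> borel_measurable borel \<and> (\<forall>x. 0 \<le> \<rho> x) \<and>
    \<mu> = density lborel (\<lambda>x. ennreal (\<rho> x))"

end

theory Submission
  imports Defs "HOL-Computational_Algebra.Fundamental_Theorem_Algebra"
begin

text \<open>
Completing the square makes stationarity algebraic. With \<open>A = (\<beta> / 2) F + z\<^sup>2 - a\<close>, the flux of
\<open>F\<close> is constantly \<open>J\<close> exactly when \<open>A\<^sup>2 = P\<close>, where \<open>P(z) = (z\<^sup>2 - a)\<^sup>2 - \<beta> (z - J)\<close>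
(\<open>flux_eq_iff_square\<close>). A stationary solution is thus a value of \<open>J\<close> together with an analytic
square root of \<open>P\<close> on the half-plane, and \<open>P' = 4 z\<^sup>3 - 4 a z - \<beta>\<close> does not depend on \<open>J\<close>.

Uniqueness. The quartic \<open>P\<close> is a square of an analytic function on the half-plane, so a root there
is a multiple root and hence a root of the cubic \<open>P'\<close>. If \<open>P\<close> has no root in the half-plane, its
four roots have nonpositive imaginary parts; their sum vanishes, so they are real, say
\<open>r\<^sub>1 \<le> r\<^sub>2 \<le> r\<^sub>3 \<le> r\<^sub>4\<close>. The branch \<open>A \<sim> z\<^sup>2\<close>, followed along the real line from the right, picks up a
factor \<open>\<i>\<close> at each root, so on \<open>(r\<^sub>1, r\<^sub>2)\<close> it is a negative multiple of \<open>\<i>\<close>. As \<open>F\<close> takes values in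
the half-plane, this interval must be empty, and \<open>r\<^sub>1 = r\<^sub>2\<close> is again a root of the cubic
(\<open>stationary_constant\<close>). For \<open>a < a\<^sup>*\<close> only the first case occurs, for \<open>a \<ge> a\<^sup>*\<close> only the second,
and the double root \<open>\<zeta>\<close>, hence \<open>J\<close>, is determined. The sign of the square root is fixed by
\<open>A \<sim> z\<^sup>2\<close> (\<open>eq_of_square_eq\<close>).

Existence. Let \<open>\<zeta>\<close> be the minimal root of the cubic or its root in the half-plane, according to the
regime. If \<open>J\<close> is chosen such that \<open>P(\<zeta>) = 0\<close>, then
\<open>P(z) = (z - \<zeta>)\<^sup>2 (z - p) (z - q)\<close> with \<open>p, q = - \<zeta> \<plusminus> s\<close> and \<open>s\<^sup>2 = 2 (a - \<zeta>\<^sup>2)\<close>. Both \<open>p\<close> and \<open>q\<close> lie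
in the closed lower half-plane, so \<open>R(z) = (z - \<zeta>) sqrt (z - p) sqrt (z - q)\<close> is analytic on the
upper half-plane and continuous up to the real line. The corresponding solution \<open>G\<close> behaves like
\<open>- 1 / z\<close> at infinity, and Cauchy's formula for \<open>G\<close> at a point and at its conjugate combine to
\<open>G(z) = (1 / \<pi>) \<integral> Im G(x) / (x - z) dx\<close> (\<open>half_plane_represents\<close>). Hence \<open>G\<close> is the Stieltjes
transform of a probability measure as soon as \<open>Im R \<ge> 0\<close> on the real line. For real \<open>\<zeta>\<close> this can
be read off the formula for \<open>R\<close>. For \<open>\<zeta> = \<xi> + \<i> \<eta>\<close> with \<open>\<eta> > 0\<close>, the imaginary part of \<open>R\<^sup>2 = P\<close> on
the real line is the constant \<open>\<beta> Im J\<close>, and \<open>Im J = \<eta>\<^sup>3 / \<bar>\<zeta>\<bar>\<^sup>2 > 0\<close>; so \<open>Im R\<close> has no real zero and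
keeps the positive sign that it has near infinity, where \<open>z\<^sup>2 G(z) + z\<close> tends to \<open>J\<close>. The latter
limit also gives the tail of the density.

Finally, a measure is determined by its Stieltjes transform (\<open>stieltjes_inj\<close>), so every measure
represented by \<open>G\<close> has the density \<open>Im G / \<pi>\<close>.
\<close>

section \<open>The Stieltjes transform determines the measure\<close>

lemma integrable_cauchy_kernel: "integrable lborel (\<lambda>x::real. 1 / (1 + x\<^sup>2))"
proof -
  have pos: "integrable lborel (\<lambda>x::real. indicator {0<..} x *\<^sub>R (1 / (1 + x\<^sup>2)))"
    using integrable_I0i_1_div_plus_square
    by (simp add: interval_lebesgue_integrable_def set_integrable_def zero_ereal_def)
  then have neg: "integrable lborel (\<lambda>x::real. indicator {0<..} (- x) *\<^sub>R (1 / (1 + x\<^sup>2)))"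
    using lborel_integrable_real_affine_iff[of "-1" "\<lambda>x::real. indicator {0<..} x *\<^sub>R (1 / (1 + x\<^sup>2))" 0]
    by simp
  show ?thesis
  proof (rule Bochner_Integration.integrable_cong_AE_imp[OF Bochner_Integration.integrable_add[OF pos neg]])
    have "AE x in lborel. x \<noteq> (0::real)"
      by (rule AE_lborel_singleton)
    then show "AE x::real in lborel. indicator {0<..} x *\<^sub>R (1 / (1 + x\<^sup>2))
        + indicator {0<..} (- x) *\<^sub>R (1 / (1 + x\<^sup>2)) = 1 / (1 + x\<^sup>2)"
      by eventually_elim (auto simp: indicator_def)
  qed simp
qed

text \<open>
A point off the real line keeps the distance \<open>\<bar>Im z\<bar>\<close> to it; this bound makes the resolvent
integrable against every probability measure.
\<close>

lemma norm_resolvent_le: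
  assumes "Im z \<noteq> 0"
  shows "norm (1 / (complex_of_real x - z)) \<le> 1 / \<bar>Im z\<bar>"
proof -
  have "\<bar>Im z\<bar> \<le> norm (complex_of_real x - z)"
    using abs_Im_le_cmod[of "complex_of_real x - z"] by simp
  then show ?thesis
    using assms by (simp add: norm_divide divide_simps)
qed

lemma integrable_resolvent:
  assumes "real_distribution M" "Im z \<noteq> 0"
  shows "integrable M (\<lambda>x. 1 / (complex_of_real x - z))"
proof -
  interpret real_distribution M by fact
  show ?thesis
    by (rule integrable_const_bound[where B = "1 / \<bar>Im z\<bar>"])
       (use norm_resolvent_le[OF assms(2)] in auto)
qed

lemma Im_resolvent:
  "Im (1 / (complex_of_real x - z)) = Im z / ((x - Re z)\<^sup>2 + (Im z)\<^sup>2)"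
  by (simp add: Im_divide cmod_power2)

lemma Im_stieltjes:
  assumes "real_distribution M" "Im z \<noteq> 0"
  shows "Im (stieltjes M z) = (LINT x|M. Im z / ((x - Re z)\<^sup>2 + (Im z)\<^sup>2))"
    and "integrable M (\<lambda>x. Im z / ((x - Re z)\<^sup>2 + (Im z)\<^sup>2))"
  using integral_Im[OF integrable_resolvent[OF assms]] integrable_Im[OF integrable_resolvent[OF assms]]
  unfolding stieltjes_def Im_resolvent by simp_all

lemma stieltjes_in_upper_half_plane:
  assumes "real_distribution M" "z \<in> upper_half_plane"
  shows "stieltjes M z \<in> upper_half_plane"
proof -
  interpret real_distribution M by fact
  have z: "Im z > 0" using assms by (simp add: upper_half_plane_def)
  let ?f = "\<lambda>x. Im z / ((x - Re z)\<^sup>2 + (Im z)\<^sup>2)"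
  have pos: "?f x > 0" for x
    using z by (auto intro!: divide_pos_pos add_nonneg_pos)
  have int: "integrable M ?f"
    using Im_stieltjes(2)[OF assms(1)] z by simp
  have "(LINT x|M. ?f x) \<noteq> 0"
  proof
    assume "(LINT x|M. ?f x) = 0"
    then have "AE x in M. ?f x = 0"
      using integral_nonneg_eq_0_iff_AE[OF int] pos by (auto simp: less_imp_le)
    then have "AE x in M. False"
      by eventually_elim (use pos in \<open>metis less_irrefl\<close>)
    then show False by simp
  qed
  moreover have "(LINT x|M. ?f x) \<ge> 0"
    by (rule integral_nonneg_AE) (use pos in \<open>auto simp: less_imp_le\<close>)
  ultimately have "(LINT x|M. ?f x) > 0" by linarith
  then show ?thesis
    using Im_stieltjes(1)[OF assms(1), of z] z by (simp add: upper_half_plane_def)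
qed

text \<open>
The integrand \<open>\<i> y / (x - \<i> y)\<close> is bounded by 1 and tends to -1 for every \<open>x\<close>.
\<close>

lemma stieltjes_at_infinity:
  assumes "real_distribution M"
  shows "((\<lambda>y::real. \<i> * of_real y * stieltjes M (\<i> * of_real y)) \<longlongrightarrow> -1) at_top"
proof -
  interpret real_distribution M by fact
  have "((\<lambda>y::real. LINT x|M. \<i> * of_real y * (1 / (complex_of_real x - \<i> * of_real y))) \<longlongrightarrow> (LINT x|M. -1)) at_top"
  proof (rule integral_dominated_convergence_at_top[where w = "\<lambda>_. 1"])
    have "((\<lambda>y::real. \<i> * of_real y * (1 / (complex_of_real x - \<i> * of_real y))) \<longlongrightarrow> - 1) at_top" for x
    proof -
      have "((\<lambda>y::real. \<i> / (complex_of_real x * of_real (inverse y) - \<i>)) \<longlongrightarrow> \<i> / (complex_of_real x * of_real 0 - \<i>)) at_top"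
        by (intro tendsto_intros tendsto_inverse_0_at_top filterlim_ident) simp
      moreover have "\<forall>\<^sub>F y::real in at_top. \<i> / (complex_of_real x * of_real (inverse y) - \<i>)
          = \<i> * of_real y * (1 / (complex_of_real x - \<i> * of_real y))"
        using eventually_gt_at_top[of 0]
      proof eventually_elim
        case (elim y)
        then have "complex_of_real x - \<i> * of_real y = of_real y * (complex_of_real x * of_real (inverse y) - \<i>)"
          by (simp add: field_simps)
        then show ?case using elim by simp
      qed
      ultimately show ?thesis
        by (auto dest: Lim_transform_eventually)
    qed
    then show "AE x in M. ((\<lambda>y::real. \<i> * of_real y * (1 / (complex_of_real x - \<i> * of_real y))) \<longlongrightarrow> - 1) at_top"
      by simp
    have "\<forall>x. norm (\<i> * of_real y * (1 / (complex_of_real x - \<i> * of_real y))) \<le> 1" if "y > 0" for y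
      using that norm_resolvent_le[of "\<i> * of_real y"]
      by (auto simp: norm_mult norm_divide field_simps)
    then show "\<forall>\<^sub>F y in at_top. AE x in M. norm (\<i> * of_real y * (1 / (complex_of_real x - \<i> * of_real y))) \<le> 1"
      by (intro eventually_mono[OF eventually_gt_at_top[of 0]] AE_I2) blast
  qed auto
  then show ?thesis
    using prob_space by (simp add: stieltjes_def del: times_divide_eq_right)
qed

text \<open>
On the horizontal line at height \<open>y\<close>, the imaginary part of the Stieltjes transform is the
convolution of the measure with the Cauchy kernel of width \<open>y\<close>. The Fourier transform of a
convolution is a product, and the substitution \<open>x = u + y s\<close> separates the two factors.
\<close>

lemma char_times_cauchy_kernel:
  assumes "real_distribution M" "y > 0"
  shows "(CLBINT x. iexp (t * x) * of_real (Im (stieltjes M (Complex x y)))) =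
         char M t * (CLBINT s. iexp (t * y * s) * of_real (1 / (1 + s\<^sup>2)))"
proof -
  interpret real_distribution M by fact
  interpret P: pair_sigma_finite lborel M ..
  define k where "k = (\<lambda>v. y / (v\<^sup>2 + y\<^sup>2))"
  let ?f = "\<lambda>x u. iexp (t * x) * complex_of_real (k (x - u))"
  have k_nonneg: "k v \<ge> 0" for v using assms by (simp add: k_def)
  have [measurable]: "k \<in> borel_measurable borel" unfolding k_def by simp
  have k_affine: "k (u + y * s - u) = (1 / y) * (1 / (1 + s\<^sup>2))" for u s
  proof -
    have "(u + y * s - u)\<^sup>2 + y\<^sup>2 = y * (y * (1 + s\<^sup>2))"
      by (simp add: power2_eq_square algebra_simps)
    then show ?thesis unfolding k_def using assms by (simp add: add_pos_nonneg less_imp_neq[symmetric])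
  qed
  have k_int: "integrable lborel (\<lambda>x. k (x - u))" for u
  proof (rule iffD1[OF lborel_integrable_real_affine_iff])
    show "integrable lborel (\<lambda>s. k (u + y * s - u))"
      unfolding k_affine by (intro integrable_mult_right integrable_cauchy_kernel)
  qed (use assms in simp)
  have k_total: "(LBINT x. k (x - u)) = (LBINT s. 1 / (1 + s\<^sup>2))" for u
  proof -
    have "(LBINT x. k (x - u)) = y * (LBINT s. k (u + y * s - u))"
      using assms by (subst lborel_integral_real_affine[where c = y and t = u]) auto
    also have "\<dots> = y * ((1 / y) * (LBINT s. 1 / (1 + s\<^sup>2)))"
      unfolding k_affine by (simp only: integral_mult_right_zero)
    finally show ?thesis using assms by simp
  qed
  have f_int: "integrable (lborel \<Otimes>\<^sub>M M) (\<lambda>(x, u). ?f x u)"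
  proof -
    interpret Q: pair_sigma_finite M lborel ..
    have "integrable (M \<Otimes>\<^sub>M lborel) (\<lambda>(u, x). ?f x u)"
    proof (rule Q.Fubini_integrable)
      show "integrable M (\<lambda>u. LBINT x. norm (case (u, x) of (u, x) \<Rightarrow> ?f x u))"
        using k_nonneg by (simp add: norm_mult k_total)
      show "AE u in M. integrable lborel (\<lambda>x. case (u, x) of (u, x) \<Rightarrow> ?f x u)"
      proof (rule AE_I2)
        fix u
        have "integrable lborel (\<lambda>x. complex_of_real (k (x - u)))"
          using k_int by (rule integrable_of_real)
        then show "integrable lborel (\<lambda>x. case (u, x) of (u, x) \<Rightarrow> ?f x u)"
          by (rule Bochner_Integration.integrable_bound) (auto simp: norm_mult)
      qed
    qed measurable
    then show ?thesis
      using P.integrable_product_swap_iff[of "\<lambda>(x, u). ?f x u"] by simp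
  qed
  have "(CLBINT x. iexp (t * x) * of_real (Im (stieltjes M (Complex x y))))
      = (CLBINT x. (CLINT u|M. ?f x u))"
  proof (rule Bochner_Integration.integral_cong[OF refl])
    fix x
    have "Im (stieltjes M (Complex x y)) = (LINT u|M. k (x - u))"
      using assms by (subst Im_stieltjes(1)) (auto simp: k_def power2_commute)
    then show "iexp (t * x) * of_real (Im (stieltjes M (Complex x y))) = (CLINT u|M. ?f x u)"
      by simp
  qed
  also have "\<dots> = (CLINT u|M. (CLBINT x. ?f x u))"
    by (rule P.Fubini_integral[OF f_int, symmetric])
  also have "\<dots> = (CLINT u|M. iexp (t * u) * (CLBINT s. iexp (t * y * s) * of_real (1 / (1 + s\<^sup>2))))"
  proof (rule Bochner_Integration.integral_cong[OF refl])
    fix u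
    have "(CLBINT x. ?f x u) = y *\<^sub>R (CLBINT s. ?f (u + y * s) u)"
      using assms by (subst lborel_integral_real_affine[where c = y and t = u]) auto
    also have "\<dots> = (CLBINT s. y *\<^sub>R ?f (u + y * s) u)"
      by simp
    also have "\<dots> = (CLBINT s. iexp (t * u) * (iexp (t * y * s) * of_real (1 / (1 + s\<^sup>2))))"
    proof (rule Bochner_Integration.integral_cong[OF refl])
      fix s
      have "iexp (t * (u + y * s)) = iexp (t * u) * iexp (t * y * s)"
        by (simp add: algebra_simps flip: exp_add)
      then show "y *\<^sub>R ?f (u + y * s) u = iexp (t * u) * (iexp (t * y * s) * of_real (1 / (1 + s\<^sup>2)))"
        using assms unfolding k_affine by (simp add: scaleR_conv_of_real)
    qed
    also have "\<dots> = iexp (t * u) * (CLBINT s. iexp (t * y * s) * of_real (1 / (1 + s\<^sup>2)))"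
      by (rule integral_mult_right_zero)
    finally show "(CLBINT x. ?f x u) = iexp (t * u) * (CLBINT s. iexp (t * y * s) * of_real (1 / (1 + s\<^sup>2)))" .
  qed
  finally show ?thesis
    by (simp add: char_def)
qed

text \<open>
For \<open>y \<rightarrow> 0\<close> the left-hand side tends to the total mass of the Cauchy kernel, so one does not have to
know its Fourier transform \<open>\<pi> exp (- \<bar>t y\<bar>)\<close>.
\<close>

lemma cauchy_kernel_char_nonzero:
  "\<exists>y>0. (CLBINT s. iexp (t * y * s) * of_real (1 / (1 + s\<^sup>2))) \<noteq> 0"
proof -
  let ?c = "\<lambda>y. CLBINT s. iexp (t * y * s) * of_real (1 / (1 + s\<^sup>2))"
  have "(\<lambda>n. ?c (1 / real (Suc n))) \<longlonglongrightarrow> (CLBINT s. of_real (1 / (1 + s\<^sup>2)))"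
  proof (rule integral_dominated_convergence[where w = "\<lambda>s. 1 / (1 + s\<^sup>2)"])
    show "AE s in lborel. (\<lambda>n. iexp (t * (1 / real (Suc n)) * s) * complex_of_real (1 / (1 + s\<^sup>2)))
        \<longlonglongrightarrow> of_real (1 / (1 + s\<^sup>2))"
    proof (rule AE_I2)
      fix s :: real
      have "(\<lambda>n. iexp (t * (1 / real (Suc n)) * s) * complex_of_real (1 / (1 + s\<^sup>2)))
          \<longlonglongrightarrow> iexp (t * 0 * s) * of_real (1 / (1 + s\<^sup>2))"
        by (intro tendsto_intros LIMSEQ_Suc lim_1_over_n)
      then show "(\<lambda>n. iexp (t * (1 / real (Suc n)) * s) * complex_of_real (1 / (1 + s\<^sup>2)))
        \<longlonglongrightarrow> of_real (1 / (1 + s\<^sup>2))" by simp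
    qed
  qed (use integrable_cauchy_kernel in \<open>auto simp: norm_mult norm_divide abs_of_nonneg simp del: of_real_divide of_real_add\<close>)
  moreover have "(CLBINT s. complex_of_real (1 / (1 + s\<^sup>2))) \<noteq> 0"
  proof
    assume "(CLBINT s. complex_of_real (1 / (1 + s\<^sup>2))) = 0"
    then have "(LBINT s. 1 / (1 + s\<^sup>2)) = (0::real)"
      by (simp only: integral_complex_of_real of_real_eq_0_iff)
    then have "AE s::real in lborel. 1 / (1 + s\<^sup>2) = 0"
      by (subst (asm) integral_nonneg_eq_0_iff_AE[OF integrable_cauchy_kernel]) auto
    moreover have "1 / (1 + s\<^sup>2) \<noteq> 0" for s :: real
      by (metis add_pos_nonneg divide_eq_0_iff less_irrefl zero_le_power2 zero_less_one zero_neq_one)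
    ultimately have "AE s::real in lborel. False" by simp
    then show False by (auto simp: AE_iff_null dest: null_setsD1)
  qed
  ultimately have "\<forall>\<^sub>F n in sequentially. ?c (1 / real (Suc n)) \<noteq> 0"
    by (rule tendsto_imp_eventually_ne)
  then obtain n where "?c (1 / real (Suc n)) \<noteq> 0"
    by (auto simp: eventually_sequentially)
  then show ?thesis
    by (intro exI[of _ "1 / real (Suc n)"]) simp
qed

text \<open>
Dividing out the nonzero Fourier transform of a Cauchy kernel recovers the characteristic function.
\<close>

lemma stieltjes_inj:
  assumes M: "real_distribution M" and N: "real_distribution N"
    and eq: "\<And>z. z \<in> upper_half_plane \<Longrightarrow> stieltjes M z = stieltjes N z"
  shows "M = N"
proof (rule Levy_uniqueness[OF M N], rule ext)
  fix t
  obtain y where y: "y > 0" and ne: "(CLBINT s. iexp (t * y * s) * of_real (1 / (1 + s\<^sup>2))) \<noteq> 0"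
    using cauchy_kernel_char_nonzero by blast
  have "stieltjes M (Complex x y) = stieltjes N (Complex x y)" for x
    using y by (intro eq) (simp add: upper_half_plane_def)
  then show "char M t = char N t"
    using char_times_cauchy_kernel[OF M y, of t] char_times_cauchy_kernel[OF N y, of t] ne by simp
qed

lemma represents_imp_normalized_pick:
  assumes "F analytic_on upper_half_plane" "represents \<mu> F"
  shows "normalized_pick F"
proof -
  have M: "real_distribution \<mu>" and F: "\<And>z. z \<in> upper_half_plane \<Longrightarrow> F z = stieltjes \<mu> z"
    using assms(2) by (auto simp: represents_def)
  have "((\<lambda>y::real. F (\<i> * of_real y) / (- 1 / (\<i> * of_real y))) \<longlongrightarrow> 1) at_top"
  proof (rule Lim_transform_eventually)
    show "((\<lambda>y::real. - (\<i> * of_real y * stieltjes \<mu> (\<i> * of_real y))) \<longlongrightarrow> 1) at_top"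
      using tendsto_minus[OF stieltjes_at_infinity[OF M]] by simp
    show "\<forall>\<^sub>F y::real in at_top. - (\<i> * of_real y * stieltjes \<mu> (\<i> * of_real y)) = F (\<i> * of_real y) / (- 1 / (\<i> * of_real y))"
      using eventually_gt_at_top[of 0]
      by eventually_elim (simp add: F upper_half_plane_def)
  qed
  then have "(\<lambda>y::real. F (\<i> * of_real y)) \<sim>[at_top] (\<lambda>y. - 1 / (\<i> * of_real y))"
    by (rule asymp_equivI'_const[where c = 1, simplified])
  then show ?thesis
    using assms(1) stieltjes_in_upper_half_plane[OF M] F by (auto simp: normalized_pick_def)
qed

section \<open>Cauchy's formula on the closed upper half-plane\<close>

text \<open>
Such a function is bounded by a multiple of \<open>1 / (1 + x\<^sup>2)\<close>.
\<close>

lemma integrable_quadratic_decay: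
  fixes g :: "real \<Rightarrow> complex"
  assumes cont: "continuous_on UNIV g"
    and decay: "\<And>x. B \<le> \<bar>x\<bar> \<Longrightarrow> norm (g x) \<le> C / x\<^sup>2"
  shows "integrable lborel g"
proof -
  define b where "b = max 1 B"
  have "compact (g ` {-b..b})"
    using cont by (intro compact_continuous_image) (auto intro: continuous_on_subset)
  then obtain K where K: "K > 0" "\<And>x. x \<in> {-b..b} \<Longrightarrow> norm (g x) \<le> K"
    using compact_imp_bounded bounded_pos by (metis image_eqI)
  define D where "D = K * (1 + b\<^sup>2) + 2 * \<bar>C\<bar>"
  have bound: "norm (g x) \<le> D * (1 / (1 + x\<^sup>2))" for x
  proof (cases "\<bar>x\<bar> \<le> b")
    case True
    then have "x\<^sup>2 \<le> b\<^sup>2"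
      by (metis abs_le_square_iff abs_of_nonneg b_def max.cobounded1 order_trans zero_le_one)
    have "norm (g x) * (1 + x\<^sup>2) \<le> K * (1 + b\<^sup>2)"
      using True K \<open>x\<^sup>2 \<le> b\<^sup>2\<close> by (intro mult_mono) (auto simp: abs_le_iff)
    also have "\<dots> \<le> D" by (simp add: D_def)
    finally show ?thesis by (simp add: field_simps add_pos_nonneg)
  next
    case False
    then have "B \<le> \<bar>x\<bar>" "1 \<le> \<bar>x\<bar>" by (auto simp: b_def)
    then have x: "1 \<le> x\<^sup>2" using one_le_power[of "\<bar>x\<bar>" 2] by simp
    have "norm (g x) * (1 + x\<^sup>2) \<le> \<bar>C\<bar> / x\<^sup>2 * (x\<^sup>2 + x\<^sup>2)"
      using decay[OF \<open>B \<le> \<bar>x\<bar>\<close>] x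
      by (intro mult_mono) (auto intro: order_trans[OF _ divide_right_mono])
    also have "\<dots> = 2 * \<bar>C\<bar>" using x \<open>1 \<le> \<bar>x\<bar>\<close> by (auto simp: field_simps)
    also have "\<dots> \<le> D" using K by (simp add: D_def)
    finally show ?thesis by (simp add: field_simps add_pos_nonneg)
  qed
  show ?thesis
  proof (rule Bochner_Integration.integrable_bound)
    show "integrable lborel (\<lambda>x::real. D * (1 / (1 + x\<^sup>2)))"
      by (intro integrable_mult_right integrable_cauchy_kernel)
    show "g \<in> borel_measurable lborel"
      using borel_measurable_continuous_onI[OF cont] by simp
    show "AE x in lborel. norm (g x) \<le> norm (D * (1 / (1 + x\<^sup>2)))"
      using bound by (intro AE_I2) (metis abs_ge_self order_trans real_norm_def)
  qed
qed

lemma convex_closed_half_plane: "convex {z. Im z \<ge> 0}"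
  using convex_halfspace_Im_ge[of 0] by simp

lemma interior_closed_half_plane: "interior {z. Im z \<ge> 0} = upper_half_plane"
  using interior_halfspace_ge[of \<i> 0] by (simp add: upper_half_plane_def inner_complex_def)

text \<open>
Cauchy's theorem and integral formula hold for the rectangle with vertices \<open>\<plusminus> r\<close> and \<open>\<plusminus> r + \<i> r\<close>, although
\<open>f\<close> is merely continuous on the side that lies on the real line. The integrand is \<open>O(1 / r\<^sup>2)\<close> on the
other three sides, whose total length is \<open>4 r\<close>, so only the integral over the real line survives
for \<open>r \<rightarrow> \<infinity>\<close>.
\<close>

lemma half_plane_cauchy:
  assumes cont: "continuous_on {z. Im z \<ge> 0} f"
    and hol: "f holomorphic_on upper_half_plane"
    and decay: "\<And>z. Im z \<ge> 0 \<Longrightarrow> B \<le> norm z \<Longrightarrow> norm (f z) \<le> C / norm z"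
    and w: "Im w \<noteq> 0"
  shows "integrable lborel (\<lambda>x. f (of_real x) / (of_real x - w))"
    and "(CLBINT x. f (of_real x) / (of_real x - w)) = (if Im w > 0 then 2 * pi * \<i> * f w else 0)"
proof -
  let ?S = "{z. Im z \<ge> 0}"
  let ?g = "\<lambda>z. f z / (z - w)"
  define V where "V = (if Im w > 0 then 2 * pi * \<i> * f w else 0)"
  \<comment> \<open>Beyond radius \<open>b\<close> the decay of \<open>f\<close> applies and \<open>\<bar>z - w\<bar> \<ge> \<bar>z\<bar> / 2\<close>.\<close>
  define b where "b = max 1 (max B (2 * norm w))"
  have g_bound: "norm (?g z) \<le> 2 * \<bar>C\<bar> / r\<^sup>2" if "Im z \<ge> 0" "r \<ge> b" "norm z \<ge> r" for z r
  proof -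
    have r: "r \<ge> 1" "r \<ge> B" "r \<ge> 2 * norm w" using that by (auto simp: b_def)
    have "norm (f z) \<le> C / norm z" using decay that r by auto
    also have "\<dots> \<le> \<bar>C\<bar> / r" using r that by (intro frac_le) auto
    finally have "norm (f z) \<le> \<bar>C\<bar> / r" .
    moreover have "norm (z - w) \<ge> r / 2"
      using norm_triangle_ineq2[of z w] r that by linarith
    ultimately have "norm (f z) / norm (z - w) \<le> (\<bar>C\<bar> / r) / (r / 2)"
      using r by (intro frac_le) auto
    then show ?thesis by (simp add: norm_divide power2_eq_square mult.commute)
  qed
  have real_ne: "complex_of_real x - w \<noteq> 0" for x
    using w by (metis Im_complex_of_real eq_iff_diff_eq_0)
  have cont_real: "continuous_on UNIV (\<lambda>x. ?g (of_real x))"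
    using real_ne by (intro continuous_intros continuous_on_compose2[OF cont]) auto
  show int: "integrable lborel (\<lambda>x. ?g (of_real x))"
  proof (rule integrable_quadratic_decay[OF cont_real])
    fix x :: real assume "b \<le> \<bar>x\<bar>"
    then show "norm (?g (of_real x)) \<le> 2 * \<bar>C\<bar> / x\<^sup>2"
      using g_bound[of "of_real x" "\<bar>x\<bar>"] by simp
  qed
  have cont_g: "continuous_on (?S - {w}) ?g"
    by (intro continuous_intros continuous_on_subset[OF cont]) auto
  have image: "path_image (rectpath (of_real (-r)) (Complex r r)) \<subseteq> ?S - {w}" if "r > b" for r
  proof -
    have r: "r > 0" "r > norm w"
      using that norm_ge_zero[of w] by (auto simp: b_def max_def split: if_splits)
    have "path_image (rectpath (of_real (-r)) (Complex r r)) \<subseteq> cbox (of_real (-r)) (Complex r r)"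
      using r by (intro path_image_rectpath_subset_cbox) auto
    then have "path_image (rectpath (of_real (-r)) (Complex r r)) \<subseteq> ?S"
      by (auto simp: in_cbox_complex_iff)
    moreover have "w \<notin> path_image (rectpath (of_real (-r)) (Complex r r))"
    proof (cases "Im w > 0")
      case True
      have "w \<in> box (of_real (-r)) (Complex r r)"
        using True r abs_Re_le_cmod[of w] abs_Im_le_cmod[of w] by (auto simp: in_box_complex_iff)
      then show ?thesis
        using r path_image_rectpath_inter_box[of "of_real (-r)" "Complex r r"] by auto
    next
      case False
      then show ?thesis using calculation w by auto
    qed
    ultimately show ?thesis by blast
  qed
  have loop: "(?g has_contour_integral V) (rectpath (of_real (-r)) (Complex r r))" if "r > b" for r
  proof -
    have r: "r > 0" "r > norm w"
      using that norm_ge_zero[of w] by (auto simp: b_def max_def split: if_splits)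
    have diff: "f field_differentiable at z" if "z \<in> interior ?S" for z
      using that holomorphic_on_imp_differentiable_at[OF hol]
      unfolding interior_closed_half_plane by (simp add: upper_half_plane_def open_halfspace_Im_gt)
    show ?thesis
    proof (cases "Im w > 0")
      case True
      have wbox: "w \<in> box (of_real (-r)) (Complex r r)"
        using True r abs_Re_le_cmod[of w] abs_Im_le_cmod[of w] by (auto simp: in_box_complex_iff)
      have "(?g has_contour_integral
          (2 * pi * \<i> * winding_number (rectpath (of_real (-r)) (Complex r r)) w * f w))
          (rectpath (of_real (-r)) (Complex r r))"
        using image[OF \<open>r > b\<close>] True diff
        by (intro Cauchy_integral_formula_weak[OF convex_closed_half_plane _ cont, where k = "{}"])
           (auto simp: interior_closed_half_plane upper_half_plane_def)
      then show ?thesis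
        using winding_number_rectpath[OF wbox] True by (simp add: V_def)
    next
      case False
      then have ne: "z - w \<noteq> 0" if "z \<in> ?S" for z
        using that w by auto
      have "(?g has_contour_integral 0) (rectpath (of_real (-r)) (Complex r r))"
      proof (rule Cauchy_theorem_convex[where S = ?S and K = "{}"])
        show "continuous_on ?S ?g"
          using ne by (intro continuous_intros cont) auto
        show "?g field_differentiable at z" if "z \<in> interior ?S - {}" for z
          using ne[of z] diff[of z] that interior_subset[of ?S]
          by (intro derivative_intros field_differentiable_divide) auto
      qed (use image[OF \<open>r > b\<close>] convex_closed_half_plane in auto)
      then show ?thesis using False by (simp add: V_def)
    qed
  qed
  have near: "norm (integral {-r..r} (\<lambda>x. ?g (of_real x)) - V) \<le> 8 * \<bar>C\<bar> / r" if "r > b" for r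
  proof -
    have r: "r > 0" "r \<ge> b"
      using that norm_ge_zero[of w] by (auto simp: b_def max_def split: if_splits)
    define p1 p2 p3 p4 where p: "p1 = complex_of_real (-r)" "p2 = complex_of_real r"
      "p3 = Complex r r" "p4 = Complex (-r) r"
    have rect: "rectpath p1 p3 = linepath p1 p2 +++ linepath p2 p3 +++ linepath p3 p4 +++ linepath p4 p1"
      by (simp add: rectpath_def Let_def p complex_of_real_def)
    have "path_image (rectpath p1 p3) \<subseteq> ?S - {w}"
      using image[OF that] by (simp add: p)
    then have segs: "closed_segment p1 p2 \<subseteq> ?S - {w}" "closed_segment p2 p3 \<subseteq> ?S - {w}"
      "closed_segment p3 p4 \<subseteq> ?S - {w}" "closed_segment p4 p1 \<subseteq> ?S - {w}"
      unfolding rect by (simp_all add: path_image_join)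
    define I where "I = (\<lambda>p q. contour_integral (linepath p q) ?g)"
    have I: "(?g has_contour_integral I p q) (linepath p q)" if "closed_segment p q \<subseteq> ?S - {w}" for p q
      unfolding I_def
      by (intro has_contour_integral_integral contour_integrable_continuous_linepath
            continuous_on_subset[OF cont_g] that)
    have "(?g has_contour_integral (I p1 p2 + (I p2 p3 + (I p3 p4 + I p4 p1)))) (rectpath p1 p3)"
      unfolding rect by (intro has_contour_integral_join I segs valid_path_join valid_path_linepath) simp_all
    then have sum: "I p1 p2 + (I p2 p3 + (I p3 p4 + I p4 p1)) = V"
      using loop[OF that] unfolding p(1,3)[symmetric] by (rule has_contour_integral_unique)
    define D where "D = 2 * \<bar>C\<bar> / r\<^sup>2"
    have I_bound: "norm (I p q) \<le> D * norm (q - p)"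
      if seg: "closed_segment p q \<subseteq> ?S - {w}" and far: "\<And>z. z \<in> closed_segment p q \<Longrightarrow> r \<le> norm z" for p q
    proof (rule has_contour_integral_bound_linepath[OF I[OF seg]])
      show "norm (?g z) \<le> D" if "z \<in> closed_segment p q" for z
        using g_bound[OF _ \<open>r \<ge> b\<close> far[OF that]] seg that by (auto simp: D_def)
    qed (simp add: D_def)
    have Re_const: "Re z = Re p" if "z \<in> closed_segment p q" "Re p = Re q" for z p q
      using that by (auto simp: in_segment left_diff_distrib)
    have Im_const: "Im z = Im p" if "z \<in> closed_segment p q" "Im p = Im q" for z p q
      using that by (auto simp: in_segment left_diff_distrib)
    have "norm (I p2 p3) \<le> D * norm (p3 - p2)"
    proof (rule I_bound[OF segs(2)])
      fix z assume "z \<in> closed_segment p2 p3"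
      from Re_const[OF this] show "r \<le> norm z"
        using abs_Re_le_cmod[of z] by (simp add: p)
    qed
    moreover have "norm (I p3 p4) \<le> D * norm (p4 - p3)"
    proof (rule I_bound[OF segs(3)])
      fix z assume "z \<in> closed_segment p3 p4"
      from Im_const[OF this] show "r \<le> norm z"
        using abs_Im_le_cmod[of z] by (simp add: p)
    qed
    moreover have "norm (I p4 p1) \<le> D * norm (p1 - p4)"
    proof (rule I_bound[OF segs(4)])
      fix z assume "z \<in> closed_segment p4 p1"
      from Re_const[OF this] show "r \<le> norm z"
        using abs_Re_le_cmod[of z] r by (simp add: p)
    qed
    moreover have "norm (p3 - p2) = r" "norm (p4 - p3) = 2 * r" "norm (p1 - p4) = r"
      using r by (simp_all add: p cmod_def real_sqrt_mult)
    ultimately have "norm (I p2 p3 + (I p3 p4 + I p4 p1)) \<le> D * (4 * r)"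
      using norm_triangle_ineq[of "I p2 p3" "I p3 p4 + I p4 p1"] norm_triangle_ineq[of "I p3 p4" "I p4 p1"]
      by simp
    moreover have "I p1 p2 = integral {-r..r} (\<lambda>x. ?g (of_real x))"
      unfolding I_def using r by (subst contour_integral_linepath_Reals_eq) (auto simp: p)
    moreover have "D * (4 * r) = 8 * \<bar>C\<bar> / r"
      using r by (simp add: D_def power2_eq_square)
    moreover have "I p1 p2 - V = - (I p2 p3 + (I p3 p4 + I p4 p1))"
      using sum by (simp add: algebra_simps)
    ultimately show ?thesis
      by (metis norm_minus_cancel)
  qed
  have "((\<lambda>r. integral {-r..r} (\<lambda>x. ?g (of_real x)) - V) \<longlongrightarrow> 0) at_top"
  proof (rule Lim_null_comparison)
    show "\<forall>\<^sub>F r in at_top. norm (integral {-r..r} (\<lambda>x. ?g (of_real x)) - V) \<le> 8 * \<bar>C\<bar> / r"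
      using near by (rule eventually_mono[OF eventually_gt_at_top])
    show "((\<lambda>r. 8 * \<bar>C\<bar> / r) \<longlongrightarrow> 0) at_top"
      by (rule tendsto_divide_0[OF tendsto_const filterlim_at_top_imp_at_infinity[OF filterlim_ident]])
  qed
  then have to_V: "((\<lambda>r. integral {-r..r} (\<lambda>x. ?g (of_real x))) \<longlongrightarrow> V) at_top"
    by (simp add: Lim_null[symmetric])
  have "((\<lambda>r. CLBINT x. indicator {-r..r} x *\<^sub>R ?g (of_real x)) \<longlongrightarrow> (CLBINT x. ?g (of_real x))) at_top"
  proof (rule integral_dominated_convergence_at_top[where w = "\<lambda>x. norm (?g (of_real x))"])
    show "integrable lborel (\<lambda>x. norm (?g (of_real x)))" using int by simp
    have [measurable]: "(\<lambda>x. ?g (of_real x)) \<in> borel_measurable borel"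
      using borel_measurable_continuous_onI[OF cont_real] by simp
    show "(\<lambda>x. ?g (of_real x)) \<in> borel_measurable lborel" by simp
    show "(\<lambda>x. indicator {-r..r} x *\<^sub>R ?g (of_real x)) \<in> borel_measurable lborel" for r :: real by simp
    show "\<forall>\<^sub>F r in at_top. AE x in lborel. norm (indicator {-r..r} x *\<^sub>R ?g (of_real x)) \<le> norm (?g (of_real x))"
      by (intro always_eventually allI AE_I2) (auto simp: indicator_def)
    show "AE x in lborel. ((\<lambda>r. indicator {-r..r} x *\<^sub>R ?g (of_real x)) \<longlongrightarrow> ?g (of_real x)) at_top"
    proof (rule AE_I2)
      fix x :: real
      have "\<forall>\<^sub>F r in at_top. ?g (of_real x) = indicator {-r..r} x *\<^sub>R ?g (of_real x)"
        using eventually_ge_at_top[of "\<bar>x\<bar>"] by eventually_elim (auto simp: indicator_def)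
      then show "((\<lambda>r. indicator {-r..r} x *\<^sub>R ?g (of_real x)) \<longlongrightarrow> ?g (of_real x)) at_top"
        by (rule Lim_transform_eventually[OF tendsto_const])
    qed
  qed
  moreover have "(CLBINT x. indicator {-r..r} x *\<^sub>R ?g (of_real x)) = integral {-r..r} (\<lambda>x. ?g (of_real x))" for r
    using set_borel_integral_eq_integral(2)[of "{-r..r}" "\<lambda>x. ?g (of_real x)"]
      integrable_mult_indicator[OF _ int, of "{-r..r}"]
    by (simp add: set_lebesgue_integral_def set_integrable_def)
  ultimately show "(CLBINT x. ?g (of_real x)) = (if Im w > 0 then 2 * pi * \<i> * f w else 0)"
    using tendsto_unique[OF _ to_V] unfolding V_def by (simp add: trivial_limit_at_top_linorder)
qed

text \<open>
Cauchy's formula gives \<open>2 \<pi> \<i> G(z) = \<integral> G(x) / (x - z) dx\<close>, and \<open>0 = \<integral> G(x) / (x - z') dx\<close> for the conjugate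
\<open>z'\<close> of \<open>z\<close>. Subtracting the conjugate of the second identity from the first leaves only the imaginary
part of \<open>G\<close> under the integral. The total mass is the limit of
\<open>y Im G(\<i> y)\<close>, by monotone convergence: this is the integral of \<open>y\<^sup>2 / (x\<^sup>2 + y\<^sup>2) \<cdot> Im G(x) / \<pi>\<close>.
\<close>

lemma half_plane_represents:
  assumes cont: "continuous_on {z. Im z \<ge> 0} G"
    and hol: "G holomorphic_on upper_half_plane"
    and decay: "\<And>z. Im z \<ge> 0 \<Longrightarrow> B \<le> norm z \<Longrightarrow> norm (G z) \<le> C / norm z"
    and asymp: "((\<lambda>y::real. \<i> * of_real y * G (\<i> * of_real y)) \<longlongrightarrow> -1) at_top"
    and nonneg: "\<And>x::real. Im (G (of_real x)) \<ge> 0"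
  shows "represents (density lborel (\<lambda>x. ennreal (Im (G (of_real x)) / pi))) G"
proof -
  define \<rho> where "\<rho> = (\<lambda>x::real. Im (G (of_real x)) / pi)"
  have \<rho>_nonneg: "\<rho> x \<ge> 0" for x using nonneg by (simp add: \<rho>_def)
  have "continuous_on UNIV \<rho>"
    unfolding \<rho>_def by (intro continuous_intros continuous_on_compose2[OF cont]) auto
  then have [measurable]: "\<rho> \<in> borel_measurable borel"
    by (rule borel_measurable_continuous_onI)
  have poisson: "integrable lborel (\<lambda>x. complex_of_real (\<rho> x) / (complex_of_real x - z))"
      "(CLBINT x. complex_of_real (\<rho> x) / (complex_of_real x - z)) = G z" if z: "z \<in> upper_half_plane" for z
  proof -
    let ?f = "\<lambda>x::real. G (of_real x) / (of_real x - z)"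
    let ?h = "\<lambda>x::real. cnj (G (of_real x) / (of_real x - cnj z))"
    have Im: "Im z > 0" using z by (simp add: upper_half_plane_def)
    have f: "integrable lborel ?f" "(CLBINT x. ?f x) = 2 * pi * \<i> * G z"
      using half_plane_cauchy[OF cont hol decay, where w = z] Im by auto
    have h: "integrable lborel ?h" "(CLBINT x. ?h x) = 0"
      using half_plane_cauchy[OF cont hol decay, where w = "cnj z"] Im
        integrable_bounded_linear[OF bounded_linear_cnj] integral_bounded_linear[OF bounded_linear_cnj]
      by (simp_all del: complex_cnj_divide)
    have split: "complex_of_real (\<rho> x) / (complex_of_real x - z) = (?f x - ?h x) / (2 * pi * \<i>)" for x
    proof -
      have "?f x - ?h x = (G (of_real x) - cnj (G (of_real x))) / (of_real x - z)"
        by (simp add: diff_divide_distrib)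
      then show ?thesis
        by (simp add: complex_diff_cnj \<rho>_def)
    qed
    show "integrable lborel (\<lambda>x. complex_of_real (\<rho> x) / (complex_of_real x - z))"
      unfolding split using f h by (intro integrable_divide Bochner_Integration.integrable_diff)
    show "(CLBINT x. complex_of_real (\<rho> x) / (complex_of_real x - z)) = G z"
      unfolding split using f h by (simp del: complex_cnj_divide)
  qed
  have mass_y: "(\<integral>\<^sup>+ x. ennreal (y\<^sup>2 / (x\<^sup>2 + y\<^sup>2) * \<rho> x) \<partial>lborel) = ennreal (y * Im (G (\<i> * of_real y)))"
    if y: "y > 0" for y :: real
  proof -
    have z: "\<i> * of_real y \<in> upper_half_plane" using y by (simp add: upper_half_plane_def)
    have eq: "y * Im (complex_of_real (\<rho> x) / (complex_of_real x - \<i> * of_real y)) = y\<^sup>2 / (x\<^sup>2 + y\<^sup>2) * \<rho> x" for x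
      by (simp add: Im_divide power2_eq_square)
    have int: "integrable lborel (\<lambda>x. y\<^sup>2 / (x\<^sup>2 + y\<^sup>2) * \<rho> x)"
      unfolding eq[symmetric] by (intro integrable_mult_right integrable_Im poisson z)
    have "(LBINT x. y\<^sup>2 / (x\<^sup>2 + y\<^sup>2) * \<rho> x) = y * Im (G (\<i> * of_real y))"
      unfolding eq[symmetric]
      using integral_Im[OF poisson(1)[OF z]] poisson(2)[OF z] by simp
    then show ?thesis
      using nn_integral_eq_integral[OF int] \<rho>_nonneg by simp
  qed
  have mass: "(\<integral>\<^sup>+ x. ennreal (\<rho> x) \<partial>lborel) = 1"
  proof -
    let ?y = "\<lambda>n. real (Suc n)"
    have "(\<lambda>n. \<integral>\<^sup>+ x. ennreal ((?y n)\<^sup>2 / (x\<^sup>2 + (?y n)\<^sup>2) * \<rho> x) \<partial>lborel) \<longlonglongrightarrow> (\<integral>\<^sup>+ x. ennreal (\<rho> x) \<partial>lborel)"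
    proof (rule nn_integral_LIMSEQ)
      show "incseq (\<lambda>n x. ennreal ((?y n)\<^sup>2 / (x\<^sup>2 + (?y n)\<^sup>2) * \<rho> x))"
      proof (intro incseq_SucI le_funI ennreal_leI mult_right_mono \<rho>_nonneg)
        fix n x
        have "(?y n)\<^sup>2 \<le> (?y (Suc n))\<^sup>2" by (intro power_mono) auto
        moreover have "s / (x\<^sup>2 + s) \<le> t / (x\<^sup>2 + t)" if "0 < s" "s \<le> t" for s t :: real
        proof -
          have "0 < x\<^sup>2 + s" "0 < x\<^sup>2 + t" using that by (auto intro: add_nonneg_pos)
          then show ?thesis using that by (simp add: divide_simps) (simp add: algebra_simps mult_right_mono)
        qed
        ultimately show "(?y n)\<^sup>2 / (x\<^sup>2 + (?y n)\<^sup>2) \<le> (?y (Suc n))\<^sup>2 / (x\<^sup>2 + (?y (Suc n))\<^sup>2)"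
          by simp
      qed
      show "(\<lambda>n. ennreal ((?y n)\<^sup>2 / (x\<^sup>2 + (?y n)\<^sup>2) * \<rho> x)) \<longlonglongrightarrow> ennreal (\<rho> x)" for x
      proof (rule tendsto_ennrealI)
        have "(\<lambda>n. (?y n)\<^sup>2 / (x\<^sup>2 + (?y n)\<^sup>2)) \<longlonglongrightarrow> 1"
          by real_asymp
        then show "(\<lambda>n. (?y n)\<^sup>2 / (x\<^sup>2 + (?y n)\<^sup>2) * \<rho> x) \<longlonglongrightarrow> \<rho> x"
          using tendsto_mult[OF _ tendsto_const[of "\<rho> x"]] by fastforce
      qed
    qed simp
    moreover have "(\<lambda>n. \<integral>\<^sup>+ x. ennreal ((?y n)\<^sup>2 / (x\<^sup>2 + (?y n)\<^sup>2) * \<rho> x) \<partial>lborel) \<longlonglongrightarrow> ennreal 1"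
    proof -
      have "(\<lambda>n. \<i> * of_real (?y n) * G (\<i> * of_real (?y n))) \<longlonglongrightarrow> -1"
        by (rule filterlim_compose[OF asymp]) real_asymp
      from tendsto_minus[OF tendsto_Re[OF this]]
      have "(\<lambda>n. ?y n * Im (G (\<i> * of_real (?y n)))) \<longlonglongrightarrow> 1"
        by simp
      then have "(\<lambda>n. ennreal (?y n * Im (G (\<i> * of_real (?y n))))) \<longlonglongrightarrow> ennreal 1"
        by (rule tendsto_ennrealI)
      then show ?thesis
        by (simp only: mass_y of_nat_0_less_iff zero_less_Suc)
    qed
    ultimately show ?thesis
      using LIMSEQ_unique by fastforce
  qed
  have "real_distribution (density lborel (\<lambda>x. ennreal (\<rho> x)))"
  proof (intro real_distribution.intro real_distribution_axioms.intro prob_spaceI)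
    show "emeasure (density lborel (\<lambda>x. ennreal (\<rho> x))) (space (density lborel (\<lambda>x. ennreal (\<rho> x)))) = 1"
      using mass by (simp add: emeasure_density)
  qed simp
  moreover have "G z = stieltjes (density lborel (\<lambda>x. ennreal (\<rho> x))) z" if "z \<in> upper_half_plane" for z
  proof -
    have "stieltjes (density lborel (\<lambda>x. ennreal (\<rho> x))) z = (CLBINT x. \<rho> x *\<^sub>R (1 / (complex_of_real x - z)))"
      unfolding stieltjes_def using \<rho>_nonneg by (subst integral_density) auto
    then show ?thesis
      using poisson(2)[OF that] by (simp add: scaleR_conv_of_real)
  qed
  ultimately show ?thesis
    by (simp add: represents_def \<rho>_def)
qed

section \<open>Square roots of quadratics on the closed upper half-plane\<close>

lemma csqrt_upper_quadrant:
  assumes "Im z \<ge> 0"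
  shows "Re (csqrt z) \<ge> 0" "Im (csqrt z) \<ge> 0"
  using assms complex_Re_le_cmod[of z] Re_csqrt[of z] by (simp_all del: csqrt.sel(1))

text \<open>
The principal square root jumps across the negative real axis, but from above it is continuous up to
and including this axis: there it is given by the half-angle formulas without a sign.
\<close>

lemma continuous_on_csqrt_closed_half_plane: "continuous_on {z. Im z \<ge> 0} csqrt"
proof -
  have "continuous_on {z. Im z \<ge> 0} (\<lambda>z. Complex (sqrt ((cmod z + Re z) / 2)) (sqrt ((cmod z - Re z) / 2)))"
    unfolding Complex_eq by (intro continuous_intros) auto
  then show ?thesis
    by (rule continuous_on_eq) (auto simp: complex_eq_iff)
qed

text \<open>
For \<open>p\<close> and \<open>q\<close> in the closed lower half-plane this is the branch of the square root of
\<open>(z - p) (z - q)\<close> that behaves like \<open>z\<close> at infinity in the closed upper half-plane.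
\<close>

definition sqrt_quad :: "complex \<Rightarrow> complex \<Rightarrow> complex \<Rightarrow> complex"
  where "sqrt_quad p q z = csqrt (z - p) * csqrt (z - q)"

lemma sqrt_quad_square: "sqrt_quad p q z ^ 2 = (z - p) * (z - q)"
  by (simp add: sqrt_quad_def power_mult_distrib)

lemma continuous_on_sqrt_quad:
  assumes "Im p \<le> 0" "Im q \<le> 0"
  shows "continuous_on {z. Im z \<ge> 0} (sqrt_quad p q)"
  unfolding sqrt_quad_def using assms
  by (intro continuous_intros continuous_on_compose2[OF continuous_on_csqrt_closed_half_plane]) auto

lemma holomorphic_on_sqrt_quad:
  assumes "Im p \<le> 0" "Im q \<le> 0"
  shows "sqrt_quad p q holomorphic_on upper_half_plane"
  unfolding sqrt_quad_def using assms
  by (intro holomorphic_intros) (auto simp: upper_half_plane_def complex_nonpos_Reals_iff)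

text \<open>
Write \<open>u\<close> and \<open>v\<close> for the two square roots. Then \<open>u v = (u\<^sup>2 + v\<^sup>2) / 2 - (u - v)\<^sup>2 / 2\<close>, where the first term is
\<open>z - (p + q) / 2\<close>. The second term is small since \<open>(u - v) (u + v) = q - p\<close> is bounded, while
\<open>\<bar>u + v\<bar>\<close> is large: both roots lie in the first quadrant and cannot cancel.
\<close>

lemma sqrt_quad_expansion:
  assumes pq: "Im p \<le> 0" "Im q \<le> 0" and z: "Im z \<ge> 0" "z \<noteq> 0" "norm z \<ge> 2 * norm p" "norm z \<ge> 2 * norm q"
  shows "norm (sqrt_quad p q z - (z - (p + q) / 2)) \<le> (norm (p - q))\<^sup>2 / norm z"
proof -
  define u v where uv: "u = csqrt (z - p)" "v = csqrt (z - q)"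
  have sq: "u\<^sup>2 = z - p" "v\<^sup>2 = z - q" by (simp_all add: uv)
  have quadrant: "Re u \<ge> 0" "Im u \<ge> 0" "Re v \<ge> 0" "Im v \<ge> 0"
    unfolding uv using pq z by (auto intro!: csqrt_upper_quadrant simp del: csqrt.simps)
  have "sqrt_quad p q z - (z - (p + q) / 2) = - ((u - v)\<^sup>2 / 2)"
  proof -
    have "z - (p + q) / 2 = (u\<^sup>2 + v\<^sup>2) / 2"
      by (simp add: sq diff_divide_distrib add_divide_distrib)
    moreover have "sqrt_quad p q z = u * v" by (simp add: sqrt_quad_def uv)
    ultimately show ?thesis
      by (simp add: power2_eq_square add_divide_distrib diff_divide_distrib algebra_simps)
  qed
  moreover have "(norm (u - v))\<^sup>2 * norm z \<le> (norm (p - q))\<^sup>2"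
  proof -
    have "norm z \<le> (norm u)\<^sup>2 + (norm v)\<^sup>2"
      using norm_triangle_ineq2[of z p] norm_triangle_ineq2[of z q] z
      by (simp add: sq flip: norm_power)
    also have "\<dots> \<le> (norm (u + v))\<^sup>2"
      using quadrant by (simp add: cmod_power2 power2_sum)
    finally have "(norm (u - v))\<^sup>2 * norm z \<le> (norm (u - v))\<^sup>2 * (norm (u + v))\<^sup>2"
      by (intro mult_left_mono) auto
    also have "\<dots> = (norm ((u - v) * (u + v)))\<^sup>2"
      by (simp add: norm_mult power_mult_distrib)
    also have "(u - v) * (u + v) = q - p"
      using sq by (simp add: power2_eq_square algebra_simps)
    finally show ?thesis by (simp add: norm_minus_commute)
  qed
  then have "(norm (u - v))\<^sup>2 \<le> (norm (p - q))\<^sup>2 / norm z"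
    using z by (simp add: pos_le_divide_eq)
  moreover have "norm ((u - v)\<^sup>2 / 2) \<le> (norm (u - v))\<^sup>2"
    by (simp add: norm_divide norm_power)
  ultimately show ?thesis
    by (metis norm_minus_cancel order_trans)
qed

text \<open>
Limits along this filter specialize to limits along the imaginary axis, which enter the
normalization of a Stieltjes transform, and along both ends of the real axis, which give the tails
of the density.
\<close>

definition half_plane_infinity :: "complex filter"
  where "half_plane_infinity = inf at_infinity (principal {z. Im z \<ge> 0})"

lemma eventually_half_plane_infinity:
  "eventually P half_plane_infinity \<longleftrightarrow> (\<exists>B. \<forall>z. Im z \<ge> 0 \<and> B \<le> norm z \<longrightarrow> P z)"
  by (auto simp: half_plane_infinity_def eventually_inf_principal eventually_at_infinity)

lemma half_plane_infinity_le: "half_plane_infinity \<le> at_infinity"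
  by (simp add: half_plane_infinity_def)

lemma filterlim_half_plane_infinity:
  assumes "filterlim f at_infinity F" "\<forall>\<^sub>F x in F. Im (f x) \<ge> 0"
  shows "filterlim f half_plane_infinity F"
  unfolding half_plane_infinity_def using assms by (simp add: filterlim_inf filterlim_principal)

lemma filterlim_imaginary_axis: "filterlim (\<lambda>y. \<i> * of_real y) half_plane_infinity at_top"
proof (rule filterlim_half_plane_infinity)
  show "filterlim (\<lambda>y. \<i> * of_real y) at_infinity at_top"
    by (intro tendsto_mult_filterlim_at_infinity[OF tendsto_const _ filterlim_of_real_at_infinity]) simp
  show "\<forall>\<^sub>F y in at_top. 0 \<le> Im (\<i> * of_real y)"
    using eventually_ge_at_top[of 0] by eventually_elim simp
qed

lemma filterlim_real_axis:
  "filterlim of_real half_plane_infinity at_top"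
  "filterlim of_real half_plane_infinity at_bot"
proof -
  show "filterlim of_real half_plane_infinity at_top"
    by (rule filterlim_half_plane_infinity[OF filterlim_of_real_at_infinity]) simp
  have "filterlim (\<lambda>x. of_real (- x) :: complex) at_infinity at_bot"
    by (rule filterlim_compose[OF filterlim_of_real_at_infinity filterlim_uminus_at_top_at_bot])
  then have "filterlim (of_real :: real \<Rightarrow> complex) at_infinity at_bot"
    by (simp add: filterlim_at_infinity_conv_norm_at_top)
  then show "filterlim of_real half_plane_infinity at_bot"
    by (rule filterlim_half_plane_infinity) simp
qed

lemma eventually_nonzero_half_plane_infinity: "\<forall>\<^sub>F z in half_plane_infinity. z \<noteq> 0"
  using filter_leD[OF half_plane_infinity_le eventually_not_equal_at_infinity[of 0]] .

lemma tendsto_const_divide_half_plane_infinity: "((\<lambda>z. c / z) \<longlongrightarrow> 0) half_plane_infinity"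
  by (rule tendsto_divide_0[OF tendsto_const]) (rule filterlim_mono[OF filterlim_ident order_refl half_plane_infinity_le])

lemma sqrt_quad_asymp:
  assumes "Im p \<le> 0" "Im q \<le> 0"
  shows "((\<lambda>z. sqrt_quad p q z / z) \<longlongrightarrow> 1) half_plane_infinity"
proof -
  have err: "((\<lambda>z. sqrt_quad p q z / z - (1 - ((p + q) / 2) / z)) \<longlongrightarrow> 0) half_plane_infinity"
  proof (rule Lim_null_comparison)
    show "\<forall>\<^sub>F z in half_plane_infinity. norm (sqrt_quad p q z / z - (1 - ((p + q) / 2) / z)) \<le> norm (((norm (p - q))\<^sup>2 / z) * (1 / z))"
      unfolding eventually_half_plane_infinity
    proof (intro exI[of _ "max 1 (max (2 * norm p) (2 * norm q))"] allI impI)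
      fix z assume "0 \<le> Im z \<and> max 1 (max (2 * cmod p) (2 * cmod q)) \<le> cmod z"
      then have z: "Im z \<ge> 0" "z \<noteq> 0" "norm z \<ge> 2 * norm p" "norm z \<ge> 2 * norm q" by auto
      have "sqrt_quad p q z / z - (1 - ((p + q) / 2) / z) = (sqrt_quad p q z - (z - (p + q) / 2)) / z"
        using z by (simp add: field_simps)
      also have "norm \<dots> \<le> ((norm (p - q))\<^sup>2 / norm z) / norm z"
        unfolding norm_divide by (intro divide_right_mono sqrt_quad_expansion assms z) simp
      finally show "norm (sqrt_quad p q z / z - (1 - ((p + q) / 2) / z)) \<le> norm (((norm (p - q))\<^sup>2 / z) * (1 / z))"
        by (simp add: norm_mult norm_divide norm_power)
    qed
    show "((\<lambda>z. norm (((norm (p - q))\<^sup>2 / z) * (1 / z))) \<longlongrightarrow> 0) half_plane_infinity"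
      by (intro tendsto_norm_zero tendsto_mult_zero tendsto_const_divide_half_plane_infinity)
  qed
  have "((\<lambda>z. 1 - ((p + q) / 2) / z) \<longlongrightarrow> 1 - 0) half_plane_infinity"
    by (intro tendsto_diff tendsto_const tendsto_const_divide_half_plane_infinity)
  from tendsto_add[OF err this] show ?thesis by simp
qed

lemma connected_upper_half_plane: "connected upper_half_plane"
  unfolding upper_half_plane_def by (rule connected_halfspace_Im_gt)

lemma open_upper_half_plane: "open upper_half_plane"
  unfolding upper_half_plane_def by (rule open_halfspace_Im_gt)

text \<open>
Where \<open>A\<close> and \<open>B\<close> differ they are opposite. If this happens at one point it happens on an open set, so
\<open>A = - B\<close> everywhere by the identity theorem, against the common asymptotics.
\<close>

lemma eq_of_square_eq:
  assumes A: "A holomorphic_on upper_half_plane" and B: "B holomorphic_on upper_half_plane"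
    and sq: "\<And>z. z \<in> upper_half_plane \<Longrightarrow> A z ^ 2 = B z ^ 2"
    and Alim: "((\<lambda>y::real. A (\<i> * of_real y) / (\<i> * of_real y)\<^sup>2) \<longlongrightarrow> 1) at_top"
    and Blim: "((\<lambda>y::real. B (\<i> * of_real y) / (\<i> * of_real y)\<^sup>2) \<longlongrightarrow> 1) at_top"
    and z: "z \<in> upper_half_plane"
  shows "A z = B z"
proof (rule ccontr)
  assume ne: "A z \<noteq> B z"
  define U where "U = {w \<in> upper_half_plane. A w - B w \<noteq> 0}"
  have "continuous_on upper_half_plane (\<lambda>w. A w - B w)"
    using A B by (intro continuous_intros holomorphic_on_imp_continuous_on)
  then have "open U"
    using continuous_openin_preimage_gen[of upper_half_plane "\<lambda>w. A w - B w" "- {0}"]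
    by (auto simp: U_def vimage_def Int_def openin_open_eq[OF open_upper_half_plane])
  have zU: "z \<in> U" using ne z by (simp add: U_def)
  have neg: "A w + B w = 0" if "w \<in> upper_half_plane" for w
  proof (rule analytic_continuation[where f = "\<lambda>w. A w + B w" and U = U and \<xi> = z])
    show "(\<lambda>w. A w + B w) holomorphic_on upper_half_plane"
      using A B by (intro holomorphic_intros)
    show "z islimpt U"
      using zU \<open>open U\<close> by (intro interior_limit_point) (simp add: interior_open)
    show "A w + B w = 0" if "w \<in> U" for w
      using sq[of w] that by (auto simp: U_def power2_eq_iff)
  qed (use that z in \<open>auto simp: open_upper_half_plane connected_upper_half_plane U_def\<close>)
  have "((\<lambda>y::real. 0 :: complex) \<longlongrightarrow> 1 + 1) at_top"
  proof (rule Lim_transform_eventually[OF tendsto_add[OF Alim Blim]])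
    show "\<forall>\<^sub>F y in at_top. A (\<i> * of_real y) / (\<i> * of_real y)\<^sup>2 + B (\<i> * of_real y) / (\<i> * of_real y)\<^sup>2 = 0"
      using eventually_gt_at_top[of 0]
    proof eventually_elim
      case (elim y)
      then show ?case
        using neg[of "\<i> * of_real y"] by (simp add: upper_half_plane_def flip: add_divide_distrib)
    qed
  qed
  then show False
    by (simp add: tendsto_const_iff)
qed

section \<open>The stationary solution attached to a double root\<close>

text \<open>
Completing the square: the difference of the two sides on the right is \<open>\<beta>\<close> times the difference on the
left.
\<close>

lemma flux_eq_iff_square:
  assumes "\<beta> \<noteq> 0"
  shows "flux \<beta> a G z = J \<longleftrightarrow>
    (of_real (\<beta> / 2) * G z + (z\<^sup>2 - of_real a))\<^sup>2 = (z\<^sup>2 - of_real a)\<^sup>2 - of_real \<beta> * (z - J)"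
proof -
  have "(of_real (\<beta> / 2) * G z + (z\<^sup>2 - of_real a))\<^sup>2 - ((z\<^sup>2 - of_real a)\<^sup>2 - of_real \<beta> * (z - J))
      = of_real \<beta> * (flux \<beta> a G z - J)"
    by (simp add: flux_def power2_eq_square field_simps)
  then show ?thesis using assms by auto
qed

text \<open>
A value \<open>J\<close> of the flux for which the quartic \<open>P\<close> has a double root \<open>\<zeta>\<close> and its remaining roots \<open>p\<close>, \<open>q\<close> lie
in the closed lower half-plane. The double root makes the square root \<open>R\<close> of \<open>P\<close> single-valued on the
upper half-plane, wherever \<open>\<zeta>\<close> lies. The case of real \<open>\<zeta>\<close>, \<open>p\<close>, \<open>q\<close> and that of \<open>\<zeta>\<close> in the upper
half-plane are the two regimes of the theorem.
\<close>

locale stationary_curve =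
  fixes \<beta> a :: real and \<zeta> p q J :: complex
  assumes \<beta>: "\<beta> > 0" and p: "Im p \<le> 0" and q: "Im q \<le> 0"
    and factor: "(z - \<zeta>)\<^sup>2 * ((z - p) * (z - q)) = (z\<^sup>2 - of_real a)\<^sup>2 - of_real \<beta> * (z - J)"
begin

definition R :: "complex \<Rightarrow> complex" where "R z = (z - \<zeta>) * sqrt_quad p q z"

definition G :: "complex \<Rightarrow> complex" where "G z = of_real (2 / \<beta>) * (of_real a - z\<^sup>2 + R z)"

lemma R_square: "R z ^ 2 = (z\<^sup>2 - of_real a)\<^sup>2 - of_real \<beta> * (z - J)"
  by (simp add: R_def power_mult_distrib sqrt_quad_square factor)

lemma R_eq: "R z = of_real (\<beta> / 2) * G z + (z\<^sup>2 - of_real a)"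
proof -
  have "of_real (\<beta> / 2) * G z = of_real (\<beta> / 2 * (2 / \<beta>)) * (of_real a - z\<^sup>2 + R z)"
    unfolding G_def of_real_mult by (simp only: mult.assoc)
  also have "\<beta> / 2 * (2 / \<beta>) = 1" using \<beta> by simp
  finally have half: "of_real (\<beta> / 2) * G z = of_real 1 * (of_real a - z\<^sup>2 + R z)" .
  show ?thesis unfolding half by simp
qed

lemma flux_G: "flux \<beta> a G z = J"
proof -
  have "\<beta> \<noteq> 0" using \<beta> by simp
  show ?thesis
    unfolding flux_eq_iff_square[OF \<open>\<beta> \<noteq> 0\<close>] R_eq[symmetric] by (rule R_square)
qed

lemma continuous_on_R: "continuous_on {z. Im z \<ge> 0} R"
  unfolding R_def by (intro continuous_intros continuous_on_sqrt_quad p q)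

lemma continuous_on_G: "continuous_on {z. Im z \<ge> 0} G"
  unfolding G_def by (intro continuous_intros continuous_on_R)

lemma holomorphic_on_R: "R holomorphic_on upper_half_plane"
  unfolding R_def by (intro holomorphic_intros holomorphic_on_sqrt_quad p q)

lemma holomorphic_on_G: "G holomorphic_on upper_half_plane"
  unfolding G_def by (intro holomorphic_intros holomorphic_on_R)

lemma R_asymp: "((\<lambda>z. R z / z\<^sup>2) \<longlongrightarrow> 1) half_plane_infinity"
proof (rule Lim_transform_eventually)
  show "((\<lambda>z. (1 - \<zeta> / z) * (sqrt_quad p q z / z)) \<longlongrightarrow> 1) half_plane_infinity"
    using tendsto_mult[OF tendsto_diff[OF tendsto_const[of 1] tendsto_const_divide_half_plane_infinity[of \<zeta>]] sqrt_quad_asymp[OF p q]]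
    by simp
  show "\<forall>\<^sub>F z in half_plane_infinity. (1 - \<zeta> / z) * (sqrt_quad p q z / z) = R z / z\<^sup>2"
    using eventually_nonzero_half_plane_infinity
    by eventually_elim (simp add: R_def power2_eq_square field_simps)
qed

text \<open>
The formula for \<open>G\<close> hides a cancellation between \<open>- z\<^sup>2\<close> and \<open>R(z)\<close>. Multiplying with the conjugate factor
\<open>z\<^sup>2 - a + R(z)\<close> turns it into \<open>G(z) = 2 (J - z) / (z\<^sup>2 - a + R(z))\<close>, whose denominator is \<open>2 z\<^sup>2\<close> to leading
order.
\<close>

lemma G_asymp: "((\<lambda>z. z * G z) \<longlongrightarrow> -1) half_plane_infinity"
proof -
  let ?D = "\<lambda>z. 1 - of_real a / z * (1 / z) + R z / z\<^sup>2"
  have D: "(?D \<longlongrightarrow> 1 - 0 * 0 + 1) half_plane_infinity"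
    by (intro tendsto_add tendsto_diff tendsto_mult tendsto_const tendsto_const_divide_half_plane_infinity R_asymp)
  then have D_ne: "\<forall>\<^sub>F z in half_plane_infinity. ?D z \<noteq> 0"
    by (rule tendsto_imp_eventually_ne) simp
  have "((\<lambda>z. 2 * (J / z - 1) / ?D z) \<longlongrightarrow> 2 * (0 - 1) / (1 - 0 * 0 + 1)) half_plane_infinity"
    by (intro tendsto_divide[OF _ D] tendsto_mult tendsto_diff tendsto_const tendsto_const_divide_half_plane_infinity) simp
  then have lim: "((\<lambda>z. 2 * (J / z - 1) / ?D z) \<longlongrightarrow> -1) half_plane_infinity" by simp
  show ?thesis
  proof (rule Lim_transform_eventually[OF lim])
    show "\<forall>\<^sub>F z in half_plane_infinity. 2 * (J / z - 1) / ?D z = z * G z"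
      using eventually_nonzero_half_plane_infinity D_ne
    proof eventually_elim
      case (elim z)
      define d where "d = z\<^sup>2 - of_real a + R z"
      have "of_real \<beta> * G z = 2 * (of_real a - z\<^sup>2 + R z)"
        using \<beta> by (simp add: G_def)
      then have "of_real \<beta> * (G z * d) = 2 * (of_real a - z\<^sup>2 + R z) * d"
        by (metis mult.assoc)
      also have "\<dots> = 2 * (R z ^ 2 - (z\<^sup>2 - of_real a)\<^sup>2)"
        by (simp add: d_def power2_eq_square algebra_simps)
      finally have "of_real \<beta> * (G z * d) = of_real \<beta> * (2 * (J - z))"
        by (simp add: R_square algebra_simps)
      then have Gd: "G z * d = 2 * (J - z)" using \<beta> by simp
      have dD: "d = z\<^sup>2 * ?D z"
        using elim(1) by (simp add: d_def power2_eq_square field_simps)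
      then have "z * G z * (z * ?D z) = 2 * (J - z)"
        using Gd by (simp add: power2_eq_square mult_ac)
      also have "\<dots> = 2 * (J / z - 1) * z"
        using elim(1) by (simp add: field_simps)
      finally have "z * G z * ?D z = 2 * (J / z - 1)"
        using elim(1) by (simp add: mult_ac)
      then show ?case using elim(2) by (simp add: divide_eq_eq)
    qed
  qed
qed

lemma G_tendsto_0: "(G \<longlongrightarrow> 0) half_plane_infinity"
proof -
  have "((\<lambda>z. z * G z * (1 / z)) \<longlongrightarrow> -1 * 0) half_plane_infinity"
    by (intro tendsto_mult G_asymp tendsto_const_divide_half_plane_infinity)
  moreover have "\<forall>\<^sub>F z in half_plane_infinity. z * G z * (1 / z) = G z"
    using eventually_nonzero_half_plane_infinity by eventually_elim simp
  ultimately have "(G \<longlongrightarrow> -1 * 0) half_plane_infinity"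
    by (rule Lim_transform_eventually)
  then show ?thesis by simp
qed

text \<open>
The flux equation expresses \<open>z\<^sup>2 G(z) + z\<close> by \<open>J\<close> and terms that vanish with \<open>G\<close>.
\<close>

lemma G_second_order: "((\<lambda>z. z\<^sup>2 * G z + z) \<longlongrightarrow> J) half_plane_infinity"
proof -
  have "z\<^sup>2 * G z + z = J + of_real a * G z - of_real (\<beta> / 4) * G z ^ 2" for z
    using flux_G[of z] by (simp add: flux_def algebra_simps)
  moreover have "((\<lambda>z. J + of_real a * G z - of_real (\<beta> / 4) * G z ^ 2) \<longlongrightarrow>
      J + of_real a * 0 - of_real (\<beta> / 4) * 0 ^ 2) half_plane_infinity"
    by (intro tendsto_intros G_tendsto_0)
  ultimately show ?thesis by simp
qed

lemma Im_G_real: "Im (G (of_real x)) = 2 / \<beta> * Im (R (of_real x))"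
  by (simp add: G_def)

lemma represents_G:
  assumes "\<And>x::real. Im (R (of_real x)) \<ge> 0"
  shows "represents (density lborel (\<lambda>x. ennreal (2 / (\<beta> * pi) * Im (R (of_real x))))) G"
proof -
  have "\<forall>\<^sub>F z in half_plane_infinity. dist (z * G z) (-1) < 1"
    using G_asymp by (rule tendstoD) simp
  then obtain B where B: "\<And>z. Im z \<ge> 0 \<Longrightarrow> B \<le> norm z \<Longrightarrow> dist (z * G z) (-1) < 1"
    by (auto simp: eventually_half_plane_infinity)
  have "norm (G z) \<le> 2 / norm z" if z: "Im z \<ge> 0" "max 1 B \<le> norm z" for z
  proof -
    have "norm (z * G z + 1) < 1" using B[of z] z by (simp add: dist_norm)
    then have "norm (z * G z) \<le> 2"
      using norm_triangle_ineq4[of "z * G z + 1" 1] by simp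
    moreover have "norm z > 0" using z by linarith
    ultimately show ?thesis
      by (subst pos_le_divide_eq) (simp_all add: norm_mult mult.commute)
  qed
  moreover have "((\<lambda>y::real. \<i> * of_real y * G (\<i> * of_real y)) \<longlongrightarrow> -1) at_top"
    by (rule filterlim_compose[OF G_asymp filterlim_imaginary_axis])
  moreover have "Im (G (of_real x)) \<ge> 0" for x
    using assms \<beta> by (simp add: Im_G_real)
  ultimately have "represents (density lborel (\<lambda>x. ennreal (Im (G (of_real x)) / pi))) G"
    by (intro half_plane_represents continuous_on_G holomorphic_on_G) 
  then show ?thesis
    by (simp add: Im_G_real)
qed

lemma has_density_of_represents:
  assumes nonneg: "\<And>x::real. Im (R (of_real x)) \<ge> 0" and \<mu>: "represents \<mu> G"
  shows "has_density \<mu> (\<lambda>x. 2 / (\<beta> * pi) * Im (R (of_real x)))"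
proof -
  have "\<mu> = density lborel (\<lambda>x. ennreal (2 / (\<beta> * pi) * Im (R (of_real x))))"
    using represents_G[OF nonneg] \<mu>
    by (intro stieltjes_inj) (auto simp: represents_def)
  moreover have "continuous_on UNIV (\<lambda>x::real. 2 / (\<beta> * pi) * Im (R (of_real x)))"
    by (intro continuous_intros continuous_on_compose2[OF continuous_on_R]) auto
  ultimately show ?thesis
    using \<beta> nonneg by (simp add: has_density_def borel_measurable_continuous_onI)
qed

text \<open>
On the real line the summand \<open>x\<close> of \<open>x\<^sup>2 G(x) + x\<close> has no imaginary part, so the limit of
\<open>x\<^sup>2 Im G(x)\<close> is \<open>Im J\<close>.
\<close>

lemma density_asymp:
  "((\<lambda>x::real. 2 / (\<beta> * pi) * Im (R (of_real x)) * x\<^sup>2) \<longlongrightarrow> Im J / pi) at_top"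
  "((\<lambda>x::real. 2 / (\<beta> * pi) * Im (R (of_real x)) * x\<^sup>2) \<longlongrightarrow> Im J / pi) at_bot"
proof -
  have eq: "2 / (\<beta> * pi) * Im (R (of_real x)) * x\<^sup>2 = Im (of_real x ^ 2 * G (of_real x) + of_real x) / pi" for x
    by (simp add: Im_G_real flip: of_real_power)
  show "((\<lambda>x::real. 2 / (\<beta> * pi) * Im (R (of_real x)) * x\<^sup>2) \<longlongrightarrow> Im J / pi) at_top"
    "((\<lambda>x::real. 2 / (\<beta> * pi) * Im (R (of_real x)) * x\<^sup>2) \<longlongrightarrow> Im J / pi) at_bot"
    unfolding eq
    by (intro tendsto_divide tendsto_Im tendsto_const filterlim_compose[OF G_second_order] filterlim_real_axis; simp)+
qed

end

section \<open>The possible values of the flux\<close>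

lemma quartic_factorization:
  fixes c d e :: complex
  obtains p1 p2 p3 p4 where
    "\<And>z. z ^ 4 + c * z\<^sup>2 + d * z + e = (z - p1) * (z - p2) * (z - p3) * (z - p4)"
proof -
  define P where "P = [:e, d, c, 0, 1:]"
  have P: "poly P z = z ^ 4 + c * z\<^sup>2 + d * z + e" for z
    by (simp add: P_def power2_eq_square power4_eq_xxxx algebra_simps)
  have "P \<noteq> 0" "degree P = 4" "lead_coeff P = 1" by (simp_all add: P_def)
  then obtain A where A: "size A = 4" "P = (\<Prod>x\<in>#A. [:- x, 1:])"
    using alg_closed_imp_factorization[of P] by auto
  obtain xs where "mset xs = A" using ex_mset by blast
  then have "length xs = 4" and xs: "P = (\<Prod>x\<leftarrow>xs. [:- x, 1:])"
    using A by (auto simp flip: prod_mset_prod_list)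
  then obtain p1 p2 p3 p4 where "xs = [p1, p2, p3, p4]"
    by (auto simp: numeral_eq_Suc length_Suc_conv)
  then have "poly P z = (z - p1) * (z - p2) * (z - p3) * (z - p4)" for z
    by (simp add: xs algebra_simps)
  then show ?thesis using that P by metis
qed

lemma monic_quartic_coeffs:
  fixes c d e p1 p2 p3 p4 :: complex
  assumes "\<And>z. z ^ 4 + c * z\<^sup>2 + d * z + e = (z - p1) * (z - p2) * (z - p3) * (z - p4)"
  shows "p1 + p2 + p3 + p4 = 0"
    and "c = p1 * p2 + (p1 + p2) * (p3 + p4) + p3 * p4"
    and "d = - (p1 * p2 * (p3 + p4) + p3 * p4 * (p1 + p2))"
proof -
  have "[:e, d, c, 0, 1:] = [:- p1, 1:] * [:- p2, 1:] * [:- p3, 1:] * [:- p4, 1:]"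
    unfolding poly_eq_poly_eq_iff[symmetric]
  proof
    fix z
    have "poly [:e, d, c, 0, 1:] z = z ^ 4 + c * z\<^sup>2 + d * z + e"
      by (simp add: power2_eq_square power4_eq_xxxx algebra_simps)
    also have "\<dots> = (z - p1) * (z - p2) * (z - p3) * (z - p4)"
      by (rule assms)
    also have "\<dots> = poly ([:- p1, 1:] * [:- p2, 1:] * [:- p3, 1:] * [:- p4, 1:]) z"
      by (simp only: poly_mult poly_pCons poly_0) simp
    finally show "poly [:e, d, c, 0, 1:] z = poly ([:- p1, 1:] * [:- p2, 1:] * [:- p3, 1:] * [:- p4, 1:]) z" .
  qed
  then have eqs: "d = - (p1 * p2 * (p3 + p4) + p3 * p4 * (p1 + p2))"
    "c = p1 * p2 + (p1 + p2) * (p3 + p4) + p3 * p4" "- (p1 + p2 + p3 + p4) = 0"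
    by (simp_all add: algebra_simps)
  then show "p1 + p2 + p3 + p4 = 0"
    "c = p1 * p2 + (p1 + p2) * (p3 + p4) + p3 * p4"
    "d = - (p1 * p2 * (p3 + p4) + p3 * p4 * (p1 + p2))"
    by (simp_all only: neg_equal_0_iff_equal)
qed

lemma normalized_pick_limit:
  assumes "normalized_pick F"
  shows "((\<lambda>y::real. \<i> * of_real y * F (\<i> * of_real y)) \<longlongrightarrow> -1) at_top"
proof -
  have "(\<lambda>y::real. F (\<i> * of_real y)) \<sim>[at_top] (\<lambda>y. - 1 / (\<i> * of_real y))"
    using assms by (simp add: normalized_pick_def)
  moreover have ne: "\<forall>\<^sub>F y::real in at_top. F (\<i> * of_real y) \<noteq> 0 \<or> - 1 / (\<i> * of_real y) \<noteq> 0"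
    using eventually_gt_at_top[of 0] by eventually_elim simp
  ultimately have "((\<lambda>y::real. F (\<i> * of_real y) / (- 1 / (\<i> * of_real y))) \<longlongrightarrow> 1) at_top"
    by (rule asymp_equivD_strong)
  from tendsto_minus[OF this] show ?thesis
    by (simp add: mult_ac)
qed

text \<open>
Since \<open>F\<close> is \<open>O(1 / y)\<close> on the imaginary axis, it is negligible against \<open>z\<^sup>2\<close>.
\<close>

lemma pick_root_asymp:
  assumes "normalized_pick F"
  shows "((\<lambda>y::real. (of_real (\<beta> / 2) * F (\<i> * of_real y) + ((\<i> * of_real y)\<^sup>2 - of_real a)) / (\<i> * of_real y)\<^sup>2) \<longlongrightarrow> 1) at_top"
proof (rule Lim_transform_eventually)
  let ?w = "\<lambda>y::real. \<i> * of_real y"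
  have alg: "c * (w * f) * (1 / w) ^ 3 + (1 - d * (1 / w)\<^sup>2) = (c * f + (w\<^sup>2 - d)) / w\<^sup>2"
    if "w \<noteq> 0" for w f c d :: complex
    using that by (simp add: field_simps power2_eq_square power3_eq_cube)
  have inv: "((\<lambda>y. 1 / ?w y) \<longlongrightarrow> 0) at_top"
    by (rule filterlim_compose[OF tendsto_const_divide_half_plane_infinity filterlim_imaginary_axis])
  have "((\<lambda>y. of_real (\<beta> / 2) * (?w y * F (?w y)) * (1 / ?w y) ^ 3 + (1 - of_real a * (1 / ?w y)\<^sup>2)) \<longlongrightarrow>
      of_real (\<beta> / 2) * (-1) * 0 ^ 3 + (1 - of_real a * 0\<^sup>2)) at_top"
    by (intro tendsto_intros inv normalized_pick_limit assms)
  then show "((\<lambda>y. of_real (\<beta> / 2) * (?w y * F (?w y)) * (1 / ?w y) ^ 3 + (1 - of_real a * (1 / ?w y)\<^sup>2)) \<longlongrightarrow> 1) at_top"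
    by simp
  show "\<forall>\<^sub>F y in at_top. of_real (\<beta> / 2) * (?w y * F (?w y)) * (1 / ?w y) ^ 3 + (1 - of_real a * (1 / ?w y)\<^sup>2)
     = (of_real (\<beta> / 2) * F (?w y) + ((?w y)\<^sup>2 - of_real a)) / (?w y)\<^sup>2"
    using eventually_gt_at_top[of 0]
  proof eventually_elim
    case (elim y)
    then have "?w y \<noteq> 0" by simp
    then show ?case
      by (rule alg)
  qed
qed

text \<open>
The two alternatives distinguish whether \<open>P\<close> has a root \<open>w\<close> in the upper half-plane. If so, \<open>P = A\<^sup>2\<close> has
derivative \<open>2 A(w) A'(w) = 0\<close> at \<open>w\<close>. If not, all roots of \<open>P\<close> are real and the two smallest coincide,
because otherwise \<open>A\<close> would have a boundary value with negative imaginary part between them; the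
inequality \<open>a \<le> 3 r\<^sup>2\<close> records that the other two roots lie to the right of \<open>r\<close>.
\<close>

lemma stationary_constant:
  assumes \<beta>: "\<beta> > 0" and F: "normalized_pick F" and flux: "\<And>z. z \<in> upper_half_plane \<Longrightarrow> flux \<beta> a F z = J"
  shows "(\<exists>w\<in>upper_half_plane. cubic \<beta> a w = 0 \<and> (w\<^sup>2 - of_real a)\<^sup>2 = of_real \<beta> * (w - J)) \<or>
    (\<exists>r::real. r < 0 \<and> a \<le> 3 * r\<^sup>2 \<and> cubic \<beta> a (of_real r) = 0 \<and>
      (of_real r ^ 2 - of_real a)\<^sup>2 = of_real \<beta> * (of_real r - J))"
proof -
  define P where "P = (\<lambda>z. (z\<^sup>2 - of_real a)\<^sup>2 - of_real \<beta> * (z - J))"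
  define A where "A = (\<lambda>z. of_real (\<beta> / 2) * F z + (z\<^sup>2 - of_real a))"
  have F_hol: "F holomorphic_on upper_half_plane"
    using F by (auto simp: normalized_pick_def analytic_on_open[OF open_upper_half_plane])
  have F_pos: "Im (F z) > 0" if "z \<in> upper_half_plane" for z
    using F that by (auto simp: normalized_pick_def upper_half_plane_def)
  have A_hol: "A holomorphic_on upper_half_plane"
    unfolding A_def by (intro holomorphic_intros F_hol)
  have A_sq: "A z ^ 2 = P z" if "z \<in> upper_half_plane" for z
    using flux[OF that] \<beta> flux_eq_iff_square[of \<beta> a F z J] by (simp add: A_def P_def)
  have P_deriv: "(P has_field_derivative cubic \<beta> a z) (at z)" for z
    unfolding P_def
    by (rule derivative_eq_intros refl | simp)+
       (simp add: cubic_def power2_eq_square power3_eq_cube algebra_simps)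
  show ?thesis
  proof (cases "\<exists>w\<in>upper_half_plane. P w = 0")
    case True
    then obtain w where w: "w \<in> upper_half_plane" "P w = 0" by blast
    have "(A has_field_derivative deriv A w) (at w)"
      using A_hol w open_upper_half_plane holomorphic_derivI by blast
    then have "((\<lambda>z. A z ^ 2) has_field_derivative 2 * A w * deriv A w) (at w)"
      by (rule derivative_eq_intros) simp
    moreover have "A w = 0" using A_sq[OF w(1)] w(2) by simp
    ultimately have "((\<lambda>z. A z ^ 2) has_field_derivative 0) (at w)" by simp
    then have "(P has_field_derivative 0) (at w)"
      by (rule has_field_derivative_transform_within_open[OF _ open_upper_half_plane w(1)]) (rule A_sq)
    then have "cubic \<beta> a w = 0" using P_deriv DERIV_unique by blast
    then show ?thesis using w by (auto simp: P_def)
  next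
    case False
    have "P z = z ^ 4 + (- 2 * of_real a) * z\<^sup>2 + (- of_real \<beta>) * z + (of_real a ^ 2 + of_real \<beta> * J)" for z
      by (simp add: P_def power2_eq_square power4_eq_xxxx algebra_simps)
    moreover obtain p1 p2 p3 p4 where
      "\<And>z. z ^ 4 + (- 2 * of_real a) * z\<^sup>2 + (- of_real \<beta>) * z + (of_real a ^ 2 + of_real \<beta> * J)
        = (z - p1) * (z - p2) * (z - p3) * (z - p4)"
      using quartic_factorization by blast
    moreover note fact = this
    ultimately have Pf: "P z = (z - p1) * (z - p2) * (z - p3) * (z - p4)" for z by metis
    have low: "Im p1 \<le> 0" "Im p2 \<le> 0" "Im p3 \<le> 0" "Im p4 \<le> 0"
      using False Pf by (auto simp: upper_half_plane_def not_less[symmetric])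
    moreover have "Im p1 + Im p2 + Im p3 + Im p4 = 0"
      using arg_cong[OF monic_quartic_coeffs(1)[OF fact], of Im] by simp
    ultimately have "Im p1 = 0" "Im p2 = 0" "Im p3 = 0" "Im p4 = 0" by linarith+
    then have Pf': "P z = (\<Prod>x\<leftarrow>[Re p1, Re p2, Re p3, Re p4]. z - of_real x)" for z
      by (simp add: Pf complex_is_Real_iff[THEN iffD2, THEN of_real_Re] mult.assoc)
    \<comment> \<open>The order of the roots matters: the argument concerns the gap between the two smallest.\<close>
    define rs where "rs = sort [Re p1, Re p2, Re p3, Re p4]"
    have "length rs = 4" "sorted rs" unfolding rs_def by simp_all
    then obtain r1 r2 r3 r4 where rs: "rs = [r1, r2, r3, r4]"
      by (auto simp: numeral_eq_Suc length_Suc_conv)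
    have le: "r1 \<le> r2" "r2 \<le> r3" "r3 \<le> r4" using \<open>sorted rs\<close> by (simp_all add: rs)
    have "mset (map (\<lambda>x. z - complex_of_real x) rs) = mset (map (\<lambda>x. z - of_real x) [Re p1, Re p2, Re p3, Re p4])" for z
      by (simp only: rs_def mset_map mset_sort)
    then have "(\<Prod>x\<leftarrow>rs. z - complex_of_real x) = (\<Prod>x\<leftarrow>[Re p1, Re p2, Re p3, Re p4]. z - of_real x)" for z
      by (metis prod_mset_prod_list)
    then have Pr: "P z = (z - of_real r1) * (z - of_real r2) * (z - of_real r3) * (z - of_real r4)" for z
      using Pf' by (simp add: rs mult.assoc)
    have eq: "z ^ 4 + (- 2 * of_real a) * z\<^sup>2 + (- of_real \<beta>) * z + (of_real a ^ 2 + of_real \<beta> * J)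
        = (z - of_real r1) * (z - of_real r2) * (z - of_real r3) * (z - of_real r4)" for z
      using Pr[of z] by (simp add: P_def power2_eq_square power4_eq_xxxx algebra_simps)
    have sum: "r1 + r2 + r3 + r4 = 0"
      using arg_cong[OF monic_quartic_coeffs(1)[OF eq], of Re] by simp
    have c2: "- 2 * a = r1 * r2 + (r1 + r2) * (r3 + r4) + r3 * r4"
    proof -
      have "complex_of_real (- 2 * a) = of_real (r1 * r2 + (r1 + r2) * (r3 + r4) + r3 * r4)"
        using monic_quartic_coeffs(2)[OF eq] by simp
      then show ?thesis by (simp only: of_real_eq_iff)
    qed
    have c1: "\<beta> = r1 * r2 * (r3 + r4) + r3 * r4 * (r1 + r2)"
    proof -
      have "complex_of_real (- \<beta>) = of_real (- (r1 * r2 * (r3 + r4) + r3 * r4 * (r1 + r2)))"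
        using monic_quartic_coeffs(3)[OF eq] by simp
      then show ?thesis by (simp only: of_real_eq_iff neg_equal_iff_equal)
    qed
    define T where "T = (\<lambda>z. sqrt_quad (of_real r1) (of_real r2) z * sqrt_quad (of_real r3) (of_real r4) z)"
    have T_sq: "T z ^ 2 = P z" for z
      by (simp add: T_def power_mult_distrib sqrt_quad_square Pr)
    have T_cont: "continuous_on {z. Im z \<ge> 0} T"
      unfolding T_def by (intro continuous_intros continuous_on_sqrt_quad) auto
    have T_hol: "T holomorphic_on upper_half_plane"
      unfolding T_def by (intro holomorphic_intros holomorphic_on_sqrt_quad) auto
    have AT: "A z = T z" if "z \<in> upper_half_plane" for z
    proof (rule eq_of_square_eq[OF A_hol T_hol _ _ _ that])
      show "A w ^ 2 = T w ^ 2" if "w \<in> upper_half_plane" for w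
        using A_sq[OF that] T_sq by simp
      show "((\<lambda>y. A (\<i> * of_real y) / (\<i> * of_real y)\<^sup>2) \<longlongrightarrow> 1) at_top"
        unfolding A_def by (rule pick_root_asymp[OF F])
      have "((\<lambda>z. (sqrt_quad (of_real r1) (of_real r2) z / z) * (sqrt_quad (of_real r3) (of_real r4) z / z)) \<longlongrightarrow> 1 * 1) half_plane_infinity"
        by (intro tendsto_mult sqrt_quad_asymp) auto
      then have "((\<lambda>z. T z / z\<^sup>2) \<longlongrightarrow> 1) half_plane_infinity"
        by (simp add: T_def power2_eq_square)
      then show "((\<lambda>y. T (\<i> * of_real y) / (\<i> * of_real y)\<^sup>2) \<longlongrightarrow> 1) at_top"
        by (rule filterlim_compose[OF _ filterlim_imaginary_axis])
    qed
    \<comment> \<open>The boundary value is approached from above, where \<open>Im A = (\<beta> / 2) Im F + Im z\<^sup>2\<close> and \<open>Im F > 0\<close>.\<close>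
    have nonneg: "Im (T (of_real x)) \<ge> 0" for x :: real
    proof -
      let ?z = "\<lambda>n. Complex x (1 / real (Suc n))"
      have z_lim: "?z \<longlonglongrightarrow> of_real x"
      proof -
        have "?z \<longlonglongrightarrow> Complex x 0"
          by (intro tendsto_Complex tendsto_const LIMSEQ_Suc lim_1_over_n)
        then show ?thesis by (simp add: complex_of_real_def)
      qed
      then have "(\<lambda>n. Im (T (?z n))) \<longlonglongrightarrow> Im (T (of_real x))"
        by (intro tendsto_Im continuous_on_tendsto_compose[OF T_cont]) auto
      moreover have "(\<lambda>n. Im ((?z n)\<^sup>2)) \<longlonglongrightarrow> Im ((of_real x)\<^sup>2)"
        by (intro tendsto_Im tendsto_power z_lim)
      moreover have "Im ((?z n)\<^sup>2) \<le> Im (T (?z n))" for n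
      proof -
        have z: "?z n \<in> upper_half_plane" by (simp add: upper_half_plane_def)
        have "Im (T (?z n)) = \<beta> / 2 * Im (F (?z n)) + Im ((?z n)\<^sup>2)"
          unfolding AT[OF z, symmetric] A_def plus_complex.sel minus_complex.sel times_complex.sel
            Re_complex_of_real Im_complex_of_real by simp
        then show ?thesis using F_pos[OF z] \<beta> by (simp del: Im_power2)
      qed
      ultimately have "Im ((of_real x)\<^sup>2) \<le> Im (T (of_real x))"
        by (intro LIMSEQ_le) auto
      then show ?thesis by (simp flip: of_real_power)
    qed
    have "r1 = r2"
    proof (rule ccontr)
      assume "r1 \<noteq> r2"
      define x where "x = (r1 + r2) / 2"
      have x: "r1 < x" "x < r2" "x < r3" "x < r4" using le \<open>r1 \<noteq> r2\<close> by (auto simp: x_def)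
      have pos: "csqrt (of_real x - of_real r1) = of_real (sqrt (x - r1))"
        using x by (simp add: csqrt_of_real flip: of_real_diff)
      have neg: "csqrt (of_real x - of_real r) = \<i> * of_real (sqrt (r - x))" if "x < r" for r
        using that csqrt_of_real'[of "x - r"] by (simp flip: of_real_diff)
      \<comment> \<open>Three roots lie to the right of \<open>x\<close>, each contributing a factor \<open>\<i>\<close>.\<close>
      have "T (of_real x) = - \<i> * of_real (sqrt (x - r1) * sqrt (r2 - x) * sqrt (r3 - x) * sqrt (r4 - x))"
      proof -
        have "c1 * (\<i> * c2) * (\<i> * c3 * (\<i> * c4)) = - \<i> * (c1 * c2 * c3 * c4)" for c1 c2 c3 c4 :: complex
          by (simp add: mult_ac)
        then show ?thesis
          using x by (simp only: T_def sqrt_quad_def pos neg of_real_mult)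
      qed
      then have "Im (T (of_real x)) = - (sqrt (x - r1) * sqrt (r2 - x) * sqrt (r3 - x) * sqrt (r4 - x))"
        by (simp del: of_real_mult)
      moreover have "sqrt (x - r1) * sqrt (r2 - x) * sqrt (r3 - x) * sqrt (r4 - x) > 0"
        using x by simp
      ultimately show False using nonneg[of x] by linarith
    qed
    define r where "r = r1"
    have s: "r3 + r4 = - 2 * r" using sum \<open>r1 = r2\<close> by (simp add: r_def)
    have m: "r3 * r4 = 3 * r\<^sup>2 - 2 * a"
      using c2 \<open>r1 = r2\<close> s by (simp add: r_def power2_eq_square algebra_simps)
    have root: "4 * r ^ 3 - 4 * a * r - \<beta> = 0"
      using c1 \<open>r1 = r2\<close> s m by (simp add: r_def power2_eq_square power3_eq_cube algebra_simps)
    have "r \<le> 0" using sum le by (simp add: r_def)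
    moreover have "r \<noteq> 0" using root \<beta> by auto
    ultimately have "r < 0" by simp
    \<comment> \<open>This product is \<open>P''(r) / 2 = 6 r\<^sup>2 - 2 a\<close>.\<close>
    have "0 \<le> (r3 - r) * (r4 - r)" using le by (intro mult_nonneg_nonneg) (auto simp: r_def)
    also have "\<dots> = r3 * r4 - (r3 + r4) * r + r\<^sup>2" by (simp add: power2_eq_square algebra_simps)
    also have "\<dots> = 6 * r\<^sup>2 - 2 * a" by (simp add: s m power2_eq_square)
    finally have "a \<le> 3 * r\<^sup>2" by simp
    have "cubic \<beta> a (of_real r) = of_real (4 * r ^ 3 - 4 * a * r - \<beta>)"
      by (simp add: cubic_def)
    then have "cubic \<beta> a (of_real r) = 0" by (simp add: root)
    moreover have "P (of_real r) = 0" by (simp add: Pr r_def)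
    ultimately show ?thesis
      using \<open>r < 0\<close> \<open>a \<le> 3 * r\<^sup>2\<close> by (auto simp: P_def)
  qed
qed

lemma (in stationary_curve) G_unique:
  assumes F: "normalized_pick F" and flux: "\<And>z. z \<in> upper_half_plane \<Longrightarrow> flux \<beta> a F z = J"
    and z: "z \<in> upper_half_plane"
  shows "F z = G z"
proof -
  define A where "A = (\<lambda>z. of_real (\<beta> / 2) * F z + (z\<^sup>2 - of_real a))"
  have F_hol: "F holomorphic_on upper_half_plane"
    using F by (auto simp: normalized_pick_def analytic_on_open[OF open_upper_half_plane])
  have "A z = R z"
  proof (rule eq_of_square_eq[OF _ holomorphic_on_R _ _ _ z])
    show "A holomorphic_on upper_half_plane"
      unfolding A_def by (intro holomorphic_intros F_hol)
    show "A w ^ 2 = R w ^ 2" if "w \<in> upper_half_plane" for w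
      using flux[OF that] \<beta> flux_eq_iff_square[of \<beta> a F w J] by (simp add: A_def R_square)
    show "((\<lambda>y. A (\<i> * of_real y) / (\<i> * of_real y)\<^sup>2) \<longlongrightarrow> 1) at_top"
      unfolding A_def by (rule pick_root_asymp[OF F])
    show "((\<lambda>y. R (\<i> * of_real y) / (\<i> * of_real y)\<^sup>2) \<longlongrightarrow> 1) at_top"
      by (rule filterlim_compose[OF R_asymp filterlim_imaginary_axis])
  qed
  then show ?thesis
    using \<beta> R_eq[of z] by (simp add: A_def)
qed

section \<open>Roots of the cubic\<close>

lemma cubic_of_real: "cubic \<beta> a (of_real x) = of_real (4 * x ^ 3 - 4 * a * x - \<beta>)"
  by (simp add: cubic_def)

lemma cubic_of_real_eq_0_iff: "cubic \<beta> a (of_real x) = 0 \<longleftrightarrow> 4 * x ^ 3 - 4 * a * x - \<beta> = 0"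
  unfolding cubic_of_real by (rule of_real_eq_0_iff)

lemma cubic_eq_factor:
  assumes "cubic \<beta> a \<zeta> = 0"
  shows "cubic \<beta> a z = 4 * (z - \<zeta>) * (z\<^sup>2 + \<zeta> * z + \<zeta>\<^sup>2 - of_real a)"
proof -
  have "cubic \<beta> a z = cubic \<beta> a z - cubic \<beta> a \<zeta>" using assms by simp
  also have "\<dots> = 4 * (z - \<zeta>) * (z\<^sup>2 + \<zeta> * z + \<zeta>\<^sup>2 - of_real a)"
    by (simp add: cubic_def power2_eq_square power3_eq_cube algebra_simps)
  finally show ?thesis .
qed

text \<open>
In terms of \<open>b = \<beta> powr (1 / 3)\<close> the threshold \<open>a\<^sup>*\<close> becomes polynomial.
\<close>

lemma cube_root_parameter:
  assumes "\<beta> > 0"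
  obtains b where "b > 0" "b ^ 3 = \<beta>" "a_star \<beta> = 3 / 4 * b\<^sup>2"
proof
  show "\<beta> powr (1 / 3) > 0" using assms by simp
  show "(\<beta> powr (1 / 3)) ^ 3 = \<beta>" using assms by (simp add: powr_power)
  show "a_star \<beta> = 3 / 4 * (\<beta> powr (1 / 3))\<^sup>2"
    using assms by (simp add: a_star_def powr_power)
qed

text \<open>
At a negative root, \<open>- x (a - 3 b\<^sup>2 / 4) = (- x - b / 2)\<^sup>2 (b - x)\<close>, which is nonnegative. At the threshold
the double root is \<open>- b / 2\<close>.
\<close>

lemma a_star_le_of_negative_root:
  assumes \<beta>: "\<beta> > 0" and x: "x < 0" "4 * x ^ 3 - 4 * a * x - \<beta> = 0"
  shows "a_star \<beta> \<le> a"
proof -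
  obtain b where b: "b > 0" "b ^ 3 = \<beta>" "a_star \<beta> = 3 / 4 * b\<^sup>2"
    using cube_root_parameter[OF \<beta>] .
  have "4 * ((- x) * (a - 3 / 4 * b\<^sup>2)) = 4 * ((- x - b / 2)\<^sup>2 * (b - x))"
    using x(2) unfolding b(2)[symmetric]
    by (simp add: power2_eq_square power3_eq_cube field_simps)
  moreover have "(- x - b / 2)\<^sup>2 * (b - x) \<ge> 0" using b x by simp
  ultimately have "0 \<le> (- x) * (a - 3 / 4 * b\<^sup>2)" by linarith
  then have "0 \<le> a - 3 / 4 * b\<^sup>2"
    using x(1) mult_pos_neg[of "- x" "a - 3 / 4 * b\<^sup>2"] by linarith
  then show ?thesis by (simp add: b)
qed

text \<open>
On the negative axis the cubic has its local maximum at \<open>- s\<close> with \<open>s = sqrt (a / 3)\<close>, where its value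
\<open>8 s\<^sup>3 - \<beta>\<close> is nonnegative exactly when \<open>a \<ge> a\<^sup>*\<close>; at \<open>- 2 s\<close> it is negative. The two ends of this
interval account for the bounds \<open>a \<le> 3 \<zeta>\<^sup>2 \<le> 4 a\<close>. The first makes \<open>\<zeta>\<close> the smallest root, the second
is the nonnegativity of the discriminant of the remaining quadratic factor.
\<close>

lemma supercritical_root:
  assumes \<beta>: "\<beta> > 0" and a: "a_star \<beta> \<le> a"
  obtains \<zeta> :: real where "\<zeta> < 0" "4 * \<zeta> ^ 3 - 4 * a * \<zeta> - \<beta> = 0" "a \<le> 3 * \<zeta>\<^sup>2" "3 * \<zeta>\<^sup>2 \<le> 4 * a" "\<zeta>\<^sup>2 \<le> a"
proof -
  obtain b where b: "b > 0" "b ^ 3 = \<beta>" "a_star \<beta> = 3 / 4 * b\<^sup>2"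
    using cube_root_parameter[OF \<beta>] .
  define s where "s = sqrt (a / 3)"
  have "(b / 2)\<^sup>2 \<le> a / 3" using a b by (simp add: power_divide)
  then have bs: "b / 2 \<le> s" unfolding s_def by (rule real_le_rsqrt)
  then have s: "s > 0" using b by linarith
  have "a \<ge> 0" using \<open>(b / 2)\<^sup>2 \<le> a / 3\<close> zero_le_power2[of "b / 2"] by linarith
  then have a_eq: "a = 3 * s\<^sup>2" by (simp add: s_def)
  let ?f = "\<lambda>x. 4 * x ^ 3 - 4 * a * x - \<beta>"
  have "(b / 2) ^ 3 \<le> s ^ 3" using bs b by (intro power_mono) auto
  then have "\<beta> \<le> 8 * s ^ 3" using b(2) by (simp add: power_divide)
  then have top: "0 \<le> ?f (- s)" by (simp add: a_eq power2_eq_square power3_eq_cube)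
  have bot: "?f (- 2 * s) \<le> 0"
    using \<beta> zero_less_power[OF s, of 3] by (simp add: a_eq power2_eq_square power3_eq_cube)
  have "\<exists>x\<ge>- 2 * s. x \<le> - s \<and> ?f x = 0"
    by (rule IVT'[of ?f "- 2 * s" 0 "- s", OF bot top]) (use s in \<open>auto intro!: continuous_intros\<close>)
  then obtain \<zeta> where \<zeta>: "- 2 * s \<le> \<zeta>" "\<zeta> \<le> - s" "?f \<zeta> = 0" by blast
  have neg: "\<zeta> < 0" using \<zeta> s by linarith
  have "s\<^sup>2 \<le> (- \<zeta>)\<^sup>2" using \<zeta> s by (intro power_mono) auto
  moreover have "(- \<zeta>)\<^sup>2 \<le> (2 * s)\<^sup>2" using \<zeta> neg by (intro power_mono) auto
  moreover have "\<zeta>\<^sup>2 \<le> a"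
  proof -
    have "4 * \<zeta> * (\<zeta>\<^sup>2 - a) = \<beta>" using \<zeta>(3) by (simp add: power2_eq_square power3_eq_cube algebra_simps)
    then have "4 * \<zeta> * (\<zeta>\<^sup>2 - a) > 0" using \<beta> by simp
    then show ?thesis using neg by (simp add: zero_less_mult_iff)
  qed
  ultimately show ?thesis
    using that[OF neg \<zeta>(3)] by (simp add: a_eq power_mult_distrib)
qed

lemma minimal_root:
  fixes \<zeta> x :: real
  assumes \<zeta>: "\<zeta> < 0" "4 * \<zeta> ^ 3 - 4 * a * \<zeta> - \<beta> = 0" "a \<le> 3 * \<zeta>\<^sup>2"
    and x: "4 * x ^ 3 - 4 * a * x - \<beta> = 0"
  shows "\<zeta> \<le> x"
proof (rule ccontr)
  assume "\<not> \<zeta> \<le> x"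
  then have lt: "x < \<zeta>" by simp
  have "4 * ((x - \<zeta>) * (x\<^sup>2 + x * \<zeta> + \<zeta>\<^sup>2 - a)) = 0"
    using \<zeta>(2) x by (simp add: power2_eq_square power3_eq_cube algebra_simps)
  then have "x\<^sup>2 + x * \<zeta> + \<zeta>\<^sup>2 = a" using lt by simp
  moreover have "\<zeta> * \<zeta> < x * \<zeta>" using lt \<zeta>(1) by (rule mult_strict_right_mono_neg)
  moreover have "x * \<zeta> < x * x" using lt \<zeta>(1) by (intro mult_strict_left_mono_neg) auto
  ultimately show False using \<zeta>(3) by (simp add: power2_eq_square)
qed

text \<open>
The quadratic cofactor of \<open>z - \<zeta>\<close> vanishes when \<open>(2 z + \<zeta>)\<^sup>2 = 4 a - 3 \<zeta>\<^sup>2\<close>, which has only real solutions.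
\<close>

lemma supercritical_all_real:
  fixes \<zeta> :: real
  assumes \<zeta>: "4 * \<zeta> ^ 3 - 4 * a * \<zeta> - \<beta> = 0" "3 * \<zeta>\<^sup>2 \<le> 4 * a" and z: "cubic \<beta> a z = 0"
  shows "z \<in> \<real>"
proof (cases "z = of_real \<zeta>")
  case False
  have "cubic \<beta> a (of_real \<zeta>) = 0" using \<zeta>(1) by (simp only: cubic_of_real_eq_0_iff)
  from cubic_eq_factor[OF this, of z] have "z\<^sup>2 + of_real \<zeta> * z + of_real \<zeta> ^ 2 - of_real a = 0"
    using z False by simp
  moreover define w where "w = 2 * z + of_real \<zeta>"
  moreover have "(2 * z + of_real \<zeta>)\<^sup>2 = 4 * (z\<^sup>2 + of_real \<zeta> * z + of_real \<zeta> ^ 2 - of_real a)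
      + of_real (4 * a - 3 * \<zeta>\<^sup>2)"
    by (simp add: power2_eq_square algebra_simps)
  ultimately have "w\<^sup>2 = of_real (4 * a - 3 * \<zeta>\<^sup>2)"
    by simp
  also have "\<dots> = (of_real (sqrt (4 * a - 3 * \<zeta>\<^sup>2)))\<^sup>2"
    using \<zeta>(2) by (simp flip: of_real_power)
  finally have "w \<in> \<real>" by (auto simp: power2_eq_iff)
  then have "(w - of_real \<zeta>) / 2 \<in> \<real>" by (intro Reals_divide Reals_diff) auto
  then show ?thesis by (simp add: w_def)
qed simp

text \<open>
The cubic has a positive root \<open>r\<close>, and its other two roots have sum \<open>- r\<close> and product \<open>r\<^sup>2 - a\<close>. If they
were real, one of them would be negative, against \<open>a < a\<^sup>*\<close>. Writing them as \<open>\<xi> \<plusminus> \<i> \<eta>\<close> expresses \<open>\<beta>\<close> and \<open>a\<close> as polynomials in \<open>\<xi>\<close>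
and \<open>\<eta>\<close>.
\<close>

lemma subcritical_root:
  assumes \<beta>: "\<beta> > 0" and a: "a < a_star \<beta>"
  obtains \<xi> \<eta> :: real where "\<xi> < 0" "\<eta> > 0" "\<beta> = - 8 * \<xi> * (\<xi>\<^sup>2 + \<eta>\<^sup>2)" "a = 3 * \<xi>\<^sup>2 - \<eta>\<^sup>2"
proof -
  let ?f = "\<lambda>x. 4 * x ^ 3 - 4 * a * x - \<beta>"
  \<comment> \<open>A point where the cubic is nonnegative: there \<open>m\<^sup>2 - a \<ge> 1\<close> and \<open>m \<ge> \<beta>\<close>.\<close>
  define m where "m = 1 + \<bar>a\<bar> + \<beta>"
  have m: "m \<ge> 1" "m \<ge> 1 + a" "m \<ge> \<beta>" using \<beta> by (auto simp: m_def)
  have "m * 1 \<le> m * m" using m by (intro mult_left_mono) auto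
  then have "1 \<le> m\<^sup>2 - a" using m unfolding power2_eq_square by linarith
  then have "m * 1 \<le> m * (m\<^sup>2 - a)" using m by (intro mult_left_mono) auto
  then have "0 \<le> ?f m" using m \<beta> by (simp add: power2_eq_square power3_eq_cube algebra_simps)
  then have "\<exists>x\<ge>0. x \<le> m \<and> ?f x = 0"
    using \<beta> m by (intro IVT'[of ?f 0 0 m]) (auto intro!: continuous_intros)
  then obtain r where r: "r \<ge> 0" "?f r = 0" by blast
  have rpos: "r > 0" using r \<beta> by (cases "r = 0") auto
  have disc: "4 * a < 3 * r\<^sup>2"
  proof (rule ccontr)
    assume "\<not> 4 * a < 3 * r\<^sup>2"
    define d where "d = sqrt (4 * a - 3 * r\<^sup>2)"
    have d: "d \<ge> 0" "d\<^sup>2 = 4 * a - 3 * r\<^sup>2" using \<open>\<not> 4 * a < 3 * r\<^sup>2\<close> by (auto simp: d_def)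
    define x where "x = - (r + d) / 2"
    have "x\<^sup>2 + r * x + r\<^sup>2 - a = (d\<^sup>2 - (4 * a - 3 * r\<^sup>2)) / 4"
      by (simp add: x_def power2_eq_square field_simps)
    then have "x\<^sup>2 + r * x + r\<^sup>2 - a = 0" by (simp add: d)
    moreover have "?f x = 4 * (x - r) * (x\<^sup>2 + r * x + r\<^sup>2 - a) + ?f r"
      by (simp add: power2_eq_square power3_eq_cube algebra_simps)
    ultimately have "?f x = 0" using r by simp
    moreover have "x < 0" using rpos d by (simp add: x_def)
    ultimately show False using a_star_le_of_negative_root[OF \<beta>] a by fastforce
  qed
  define \<eta> where "\<eta> = sqrt (3 * r\<^sup>2 / 4 - a)"
  have \<eta>: "\<eta> > 0" "\<eta>\<^sup>2 = 3 * r\<^sup>2 / 4 - a" using disc by (auto simp: \<eta>_def)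
  show ?thesis
  proof (rule that[of "- r / 2" \<eta>])
    show "\<beta> = - 8 * (- r / 2) * ((- r / 2)\<^sup>2 + \<eta>\<^sup>2)"
      using r(2) unfolding \<eta>(2) by (simp add: power2_eq_square power3_eq_cube field_simps)
    show "a = 3 * (- r / 2)\<^sup>2 - \<eta>\<^sup>2" unfolding \<eta>(2) by (simp add: power2_eq_square)
  qed (use rpos \<eta> in auto)
qed

text \<open>
Here \<open>J\<close> is the value of the flux for which the quartic vanishes at \<open>\<zeta>\<close>. As \<open>\<zeta>\<close> is a critical point, it is a
double root, and the other two roots are found from the vanishing cubic coefficient.
\<close>

lemma double_root_factorization:
  assumes \<beta>: "\<beta> \<noteq> 0" and root: "cubic \<beta> a \<zeta> = 0" and s: "s\<^sup>2 = 2 * (of_real a - \<zeta>\<^sup>2)"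
    and J: "J = \<zeta> - 1 / of_real \<beta> * (\<zeta>\<^sup>2 - of_real a)\<^sup>2"
  shows "(z - \<zeta>)\<^sup>2 * ((z - (- \<zeta> + s)) * (z - (- \<zeta> - s))) = (z\<^sup>2 - of_real a)\<^sup>2 - of_real \<beta> * (z - J)"
proof -
  have \<beta>J: "of_real \<beta> * J = of_real \<beta> * \<zeta> - (\<zeta>\<^sup>2 - of_real a)\<^sup>2"
    using \<beta> by (simp add: J right_diff_distrib)
  have \<beta>_eq: "of_real \<beta> = 4 * \<zeta> ^ 3 - 4 * of_real a * \<zeta>"
    using root by (simp add: cubic_def)
  have "(z - \<zeta>)\<^sup>2 * ((z - (- \<zeta> + s)) * (z - (- \<zeta> - s))) = (z - \<zeta>)\<^sup>2 * ((z + \<zeta>)\<^sup>2 - s\<^sup>2)"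
    by (simp add: power2_eq_square algebra_simps)
  also have "\<dots> = (z\<^sup>2 - of_real a)\<^sup>2 - (4 * \<zeta> ^ 3 - 4 * of_real a * \<zeta>) * (z - \<zeta>) - (\<zeta>\<^sup>2 - of_real a)\<^sup>2"
    unfolding s by (simp add: power2_eq_square power3_eq_cube algebra_simps)
  also have "\<dots> = (z\<^sup>2 - of_real a)\<^sup>2 - of_real \<beta> * (z - J)"
    unfolding right_diff_distrib[of "of_real \<beta>"] \<beta>J \<beta>_eq[symmetric] by (simp add: right_diff_distrib)
  finally show ?thesis .
qed

lemma upper_csqrt_eqI:
  assumes "w\<^sup>2 = z" "Im w > 0"
  shows "upper_csqrt z = w"
proof -
  have "cis (Arg2pi z / 2) ^ 2 = cis (Arg2pi z)"
    by (simp add: power2_eq_square cis_mult)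
  then have "upper_csqrt z ^ 2 = of_real ((sqrt (cmod z))\<^sup>2) * cis (Arg2pi z)"
    by (simp only: upper_csqrt_def power_mult_distrib of_real_power)
  also have "\<dots> = z"
    using Arg2pi_eq[of z] by (simp add: cis_conv_exp)
  finally have "upper_csqrt z ^ 2 = w\<^sup>2" using assms(1) by simp
  then have "upper_csqrt z = w \<or> upper_csqrt z = - w" by (simp only: power2_eq_iff)
  moreover have "Im (upper_csqrt z) \<ge> 0"
    using Arg2pi_ge_0[of z] Arg2pi_lt_2pi[of z]
    by (auto simp: upper_csqrt_def intro!: mult_nonneg_nonneg sin_ge_zero)
  ultimately show ?thesis using assms(2) by auto
qed

section \<open>Boundary values and the main theorem\<close>

lemma asymp_equiv_inverse_square:
  fixes f :: "real \<Rightarrow> real"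
  assumes lim: "((\<lambda>x. f x * x\<^sup>2) \<longlongrightarrow> c) F" and c: "c \<noteq> 0"
  shows "f \<sim>[F] (\<lambda>x. c / x\<^sup>2)"
proof (rule asymp_equivI'_const[where c = 1, simplified])
  have "((\<lambda>x. f x * x\<^sup>2 / c) \<longlongrightarrow> c / c) F"
    by (intro tendsto_divide lim tendsto_const c)
  then show "((\<lambda>x. f x / (c / x\<^sup>2)) \<longlongrightarrow> 1) F"
    using c by (simp add: field_simps)
qed

context stationary_curve
begin

text \<open>
What remains to be supplied in each regime: the sign of the boundary values, and that every
normalized Pick function with constant flux has the flux \<open>J\<close>. Both directions of the last conjunct go
through uniqueness, which holds among normalized Pick functions and not only among Stieltjes
transforms.
\<close>

lemma exists_unique_stationary:
  assumes nonneg: "\<And>x::real. Im (R (of_real x)) \<ge> 0"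
    and flux_value: "\<forall>F K. normalized_pick F \<and> (\<forall>z\<in>upper_half_plane. flux \<beta> a F z = K) \<longrightarrow> K = J"
  shows "G analytic_on upper_half_plane \<and> (\<exists>\<mu>. represents \<mu> G) \<and> stationary \<beta> a G \<and>
    (\<forall>F. F analytic_on upper_half_plane \<and> (\<exists>\<mu>. represents \<mu> F) \<and> stationary \<beta> a F \<longrightarrow>
       (\<forall>z\<in>upper_half_plane. F z = G z)) \<and>
    (\<forall>F. F analytic_on upper_half_plane \<and> stationary \<beta> a F \<longrightarrow>
       ((\<exists>\<mu>. represents \<mu> F) \<longleftrightarrow> normalized_pick F))"
proof -
  have rep: "\<exists>\<mu>. represents \<mu> G" using represents_G[OF nonneg] by blast
  have unique: "\<forall>z\<in>upper_half_plane. F z = G z" if "normalized_pick F" "stationary \<beta> a F" for F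
    using that flux_value G_unique[OF that(1)] unfolding stationary_def by metis
  have pick: "normalized_pick F" if "F analytic_on upper_half_plane" "represents \<mu> F" for F \<mu>
    using represents_imp_normalized_pick that by blast
  have "\<exists>\<mu>. represents \<mu> F" if "normalized_pick F" "stationary \<beta> a F" for F
    using unique[OF that] rep by (auto simp: represents_def)
  moreover have "G analytic_on upper_half_plane"
    using holomorphic_on_G by (simp add: analytic_on_open open_upper_half_plane)
  moreover have "stationary \<beta> a G" using flux_G by (auto simp: stationary_def)
  ultimately show ?thesis using rep unique pick by blast
qed

text \<open>
On the real line \<open>R\<^sup>2\<close> has the constant imaginary part \<open>\<beta> Im J\<close>, so \<open>R\<close> is never real there and its imaginary
part keeps one sign. This sign is positive because \<open>x\<^sup>2 Im R(x)\<close> tends to a positive limit.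
\<close>

lemma Im_R_pos:
  assumes J: "Im J > 0"
  shows "Im (R (of_real x)) > 0"
proof -
  let ?f = "\<lambda>x::real. Im (R (of_real x))"
  have ne: "?f x \<noteq> 0" for x
  proof
    assume zero: "?f x = 0"
    have "Im (R (of_real x) ^ 2) = \<beta> * Im J"
      unfolding R_square by (simp flip: of_real_power of_real_diff)
    then show False using zero \<beta> J by (simp add: power2_eq_square)
  qed
  have "\<forall>\<^sub>F x in at_top. 2 / (\<beta> * pi) * ?f x * x\<^sup>2 > 0"
    using density_asymp(1) by (rule order_tendstoD) (use J in simp)
  then obtain x1 where "2 / (\<beta> * pi) * ?f x1 * x1\<^sup>2 > 0"
    using eventually_happens trivial_limit_at_top_linorder by blast
  then have x1: "?f x1 > 0"
    using \<beta> by (auto simp: zero_less_mult_iff zero_less_divide_iff mult_less_0_iff)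
  have "connected (range ?f)"
    by (intro connected_continuous_image connected_UNIV continuous_intros
          continuous_on_compose2[OF continuous_on_R]) auto
  show ?thesis
  proof (rule ccontr)
    assume "\<not> ?f x > 0"
    then have "0 \<in> {?f x..?f x1}" using x1 by simp
    moreover have "{?f x..?f x1} \<subseteq> range ?f"
      using \<open>connected (range ?f)\<close> by (rule connected_contains_Icc) auto
    ultimately show False using ne by fastforce
  qed
qed

end

text \<open>
To the right of both branch points the two square roots are real, to the left of both they are
imaginary with a real product, and only in between is the product imaginary. The bound on \<open>d\<close> says
that \<open>\<zeta>\<close> lies to the left of the interval, so that \<open>x - \<zeta>\<close> is nonnegative on it.
\<close>

lemma supercritical_boundary:
  fixes \<zeta> d x :: real
  assumes d: "d \<ge> 0" "d\<^sup>2 \<le> 4 * \<zeta>\<^sup>2" "\<zeta> < 0" and g: "gm = - \<zeta> - d" "gp = - \<zeta> + d"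
  shows "Im ((of_real x - of_real \<zeta>) * sqrt_quad (of_real gp) (of_real gm) (of_real x))
      = (if x \<in> {gm..gp} then (x - \<zeta>) * sqrt ((x - gm) * (gp - x)) else 0)"
    and "0 \<le> (if x \<in> {gm..gp} then (x - \<zeta>) * sqrt ((x - gm) * (gp - x)) else 0)"
proof -
  have sqrt_eq: "csqrt (of_real x - of_real r) = (if r \<le> x then of_real (sqrt (x - r)) else \<i> * of_real (sqrt (r - x)))" for r
    using csqrt_of_real'[of "x - r"] by (simp flip: of_real_diff)
  have "gm \<le> gp" using d by (simp add: g)
  then show "Im ((of_real x - of_real \<zeta>) * sqrt_quad (of_real gp) (of_real gm) (of_real x))
      = (if x \<in> {gm..gp} then (x - \<zeta>) * sqrt ((x - gm) * (gp - x)) else 0)"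
    unfolding sqrt_quad_def sqrt_eq
    by (auto simp: real_sqrt_mult)
  have "d \<le> - 2 * \<zeta>"
    using d by - (rule power2_le_imp_le, auto simp: power_mult_distrib)
  then have "\<zeta> \<le> gm" by (simp add: g)
  then show "0 \<le> (if x \<in> {gm..gp} then (x - \<zeta>) * sqrt ((x - gm) * (gp - x)) else 0)" by auto
qed

text \<open>
Here \<open>s\<close> is half the difference of the roots \<open>- \<zeta> \<plusminus> s\<close>, which stay in the lower half-plane as long as
\<open>\<bar>Im s\<bar> \<le> \<eta>\<close>. With \<open>s = u + \<i> v\<close>, the equations \<open>u\<^sup>2 - v\<^sup>2 = 4 \<xi>\<^sup>2\<close> and \<open>u v = - 2 \<xi> \<eta>\<close> give
\<open>v\<^sup>2 (4 \<xi>\<^sup>2 + v\<^sup>2) = 4 \<xi>\<^sup>2 \<eta>\<^sup>2\<close>.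
\<close>

lemma subcritical_lower_half_plane:
  fixes \<xi> \<eta> :: real and s :: complex
  assumes \<eta>: "\<eta> > 0" and s: "s\<^sup>2 = 4 * of_real \<xi> * Complex \<xi> (- \<eta>)"
  shows "\<bar>Im s\<bar> \<le> \<eta>"
proof (rule ccontr)
  assume "\<not> \<bar>Im s\<bar> \<le> \<eta>"
  then have "\<eta>\<^sup>2 < (Im s)\<^sup>2"
    using \<eta> by (metis abs_of_pos abs_le_square_iff not_le)
  have re: "(Re s)\<^sup>2 - (Im s)\<^sup>2 = 4 * \<xi>\<^sup>2" and im: "Re s * Im s = - 2 * \<xi> * \<eta>"
    using arg_cong[OF s, of Re] arg_cong[OF s, of Im] by (simp_all add: power2_eq_square mult_ac)
  have "(Im s)\<^sup>2 * (4 * \<xi>\<^sup>2 + (Im s)\<^sup>2) = (Re s * Im s)\<^sup>2"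
    using re by (simp add: power_mult_distrib algebra_simps)
  also have "\<dots> = 4 * \<xi>\<^sup>2 * \<eta>\<^sup>2" unfolding im by (simp add: power_mult_distrib)
  also have "\<dots> \<le> 4 * \<xi>\<^sup>2 * (Im s)\<^sup>2"
    using \<open>\<eta>\<^sup>2 < (Im s)\<^sup>2\<close> by (intro mult_left_mono) auto
  finally have "(Im s)\<^sup>2 * (Im s)\<^sup>2 \<le> 0" by (simp add: algebra_simps)
  then have "Im s = 0" by (simp add: mult_le_0_iff)
  then show False using \<open>\<eta>\<^sup>2 < (Im s)\<^sup>2\<close> by simp
qed

theorem theorem5p1:
  fixes \<beta> a :: real
  assumes "\<beta> \<in> {1, 2, 4}"
    and "a < a_star \<beta> \<Longrightarrow> convergence_property \<beta> a"
  shows "\<exists>G. G analytic_on upper_half_plane \<and> (\<exists>\<mu>. represents \<mu> G) \<and> stationary \<beta> a G \<and>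
    (\<forall>F. F analytic_on upper_half_plane \<and> (\<exists>\<mu>. represents \<mu> F) \<and> stationary \<beta> a F \<longrightarrow>
       (\<forall>z\<in>upper_half_plane. F z = G z)) \<and>
    (\<forall>F. F analytic_on upper_half_plane \<and> stationary \<beta> a F \<longrightarrow>
       ((\<exists>\<mu>. represents \<mu> F) \<longleftrightarrow> normalized_pick F)) \<and>
    (a \<ge> a_star \<beta> \<longrightarrow>
       (\<forall>z. cubic \<beta> a z = 0 \<longrightarrow> z \<in> \<real>) \<and>
       (\<exists>\<zeta>::real. cubic \<beta> a (of_real \<zeta>) = 0 \<and>
          (\<forall>x::real. cubic \<beta> a (of_real x) = 0 \<longrightarrow> \<zeta> \<le> x) \<and>
          (let \<gamma>m = - \<zeta> - sqrt (2 * (a - \<zeta>\<^sup>2));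
               \<gamma>p = - \<zeta> + sqrt (2 * (a - \<zeta>\<^sup>2));
               \<rho> = (\<lambda>x. if x \<in> {\<gamma>m..\<gamma>p}
                        then 2 / (\<beta> * pi) * (x - \<zeta>) * sqrt ((x - \<gamma>m) * (\<gamma>p - x)) else 0)
           in \<zeta>\<^sup>2 \<le> a \<and> (\<forall>\<mu>. represents \<mu> G \<longrightarrow> has_density \<mu> \<rho>)))) \<and>
    (a < a_star \<beta> \<longrightarrow>
       (\<exists>\<zeta>::complex. \<zeta> \<in> upper_half_plane \<and> cubic \<beta> a \<zeta> = 0 \<and>
          (\<forall>w\<in>upper_half_plane. cubic \<beta> a w = 0 \<longrightarrow> w = \<zeta>) \<and>
          (let J = \<zeta> - 1 / of_real \<beta> * (\<zeta>\<^sup>2 - of_real a)\<^sup>2;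
               P = (\<lambda>z::complex. (z\<^sup>2 - of_real a)\<^sup>2 - of_real \<beta> * (z - J));
               \<rho> = (\<lambda>x::real. 2 / (\<beta> * pi) * Im (upper_csqrt (P (of_real x))));
               C = 1 / pi * Im J
           in (\<forall>\<mu>. represents \<mu> G \<longrightarrow> has_density \<mu> \<rho>) \<and>
              closure {x. \<rho> x \<noteq> 0} = UNIV \<and>
              C > 0 \<and>
              \<rho> \<sim>[at_top] (\<lambda>x. C / x\<^sup>2) \<and>
              \<rho> \<sim>[at_bot] (\<lambda>x. C / x\<^sup>2))))"
proof -
  have \<beta>: "\<beta> > 0" using assms(1) by auto
  have conjunction: "A \<and> B \<and> C \<and> D \<and> E \<Longrightarrow> X \<Longrightarrow> Y \<Longrightarrow> A \<and> B \<and> C \<and> D \<and> E \<and> X \<and> Y" for A B C D E X Y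
    by blast
  show ?thesis
  proof (cases "a_star \<beta> \<le> a")
    case True
    obtain \<zeta> :: real where \<zeta>: "\<zeta> < 0" "4 * \<zeta> ^ 3 - 4 * a * \<zeta> - \<beta> = 0" "a \<le> 3 * \<zeta>\<^sup>2" "3 * \<zeta>\<^sup>2 \<le> 4 * a" "\<zeta>\<^sup>2 \<le> a"
      using supercritical_root[OF \<beta> True] .
    define d where "d = sqrt (2 * (a - \<zeta>\<^sup>2))"
    have d: "d \<ge> 0" "d\<^sup>2 = 2 * (a - \<zeta>\<^sup>2)" using \<zeta> by (auto simp: d_def)
    define gm gp where g: "gm = - \<zeta> - d" "gp = - \<zeta> + d"
    define J where "J = of_real \<zeta> - 1 / of_real \<beta> * ((of_real \<zeta>)\<^sup>2 - complex_of_real a)\<^sup>2"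
    have root: "cubic \<beta> a (of_real \<zeta>) = 0" using \<zeta>(2) by (simp only: cubic_of_real_eq_0_iff)
    interpret stationary_curve \<beta> a "of_real \<zeta>" "of_real gp" "of_real gm" J
    proof
      fix z :: complex
      have "(of_real d)\<^sup>2 = 2 * (of_real a - (complex_of_real \<zeta>)\<^sup>2)"
        using arg_cong[OF d(2), of complex_of_real] by simp
      from double_root_factorization[OF _ root this J_def, of z]
      show "(z - of_real \<zeta>)\<^sup>2 * ((z - of_real gp) * (z - of_real gm)) = (z\<^sup>2 - of_real a)\<^sup>2 - of_real \<beta> * (z - J)"
        using \<beta> by (simp add: g)
    qed (use \<beta> in auto)
    have d4: "d\<^sup>2 \<le> 4 * \<zeta>\<^sup>2" using \<zeta> d by simp
    have Im_R: "Im (R (of_real x)) = (if x \<in> {gm..gp} then (x - \<zeta>) * sqrt ((x - gm) * (gp - x)) else 0)" for x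
      using supercritical_boundary(1)[OF d(1) d4 \<zeta>(1) g, of x] by (simp add: R_def)
    have nonneg: "Im (R (of_real x)) \<ge> 0" for x
      using supercritical_boundary(2)[OF d(1) d4 \<zeta>(1) g, of x] unfolding Im_R .
    have all_real: "z \<in> \<real>" if "cubic \<beta> a z = 0" for z
      using supercritical_all_real[OF \<zeta>(2,4) that] .
    have minimal: "\<zeta> \<le> x" if "cubic \<beta> a (of_real x) = 0" for x
      using minimal_root[OF \<zeta>(1-3)] that by (simp only: cubic_of_real_eq_0_iff)
    have flux_value: "\<forall>F K. normalized_pick F \<and> (\<forall>z\<in>upper_half_plane. flux \<beta> a F z = K) \<longrightarrow> K = J"
    proof (intro allI impI, elim conjE)
      fix F K
      assume F: "normalized_pick F" "\<forall>z\<in>upper_half_plane. flux \<beta> a F z = K"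
      have "\<not> (\<exists>w\<in>upper_half_plane. cubic \<beta> a w = 0 \<and> (w\<^sup>2 - of_real a)\<^sup>2 = of_real \<beta> * (w - K))"
        using all_real by (auto simp: upper_half_plane_def complex_is_Real_iff)
      then obtain r :: real where r: "r < 0" "a \<le> 3 * r\<^sup>2" "cubic \<beta> a (of_real r) = 0"
          "(of_real r ^ 2 - of_real a)\<^sup>2 = of_real \<beta> * (of_real r - K)"
        using stationary_constant[OF \<beta> F(1), of a K] F(2) by blast
      have "r \<le> \<zeta>"
        using minimal_root[OF r(1) _ r(2) \<zeta>(2)] r(3) by (simp only: cubic_of_real_eq_0_iff)
      then have "r = \<zeta>" using minimal[OF r(3)] by simp
      then show "K = J" using r(4) \<beta> by (simp add: J_def)
    qed
    have "\<zeta>\<^sup>2 \<le> a \<and> (\<forall>\<mu>. represents \<mu> G \<longrightarrow> has_density \<mu>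
        (\<lambda>x. if x \<in> {gm..gp} then 2 / (\<beta> * pi) * (x - \<zeta>) * sqrt ((x - gm) * (gp - x)) else 0))"
    proof (intro conjI allI impI)
      fix \<mu> assume "represents \<mu> G"
      then have "has_density \<mu> (\<lambda>x. 2 / (\<beta> * pi) * Im (R (of_real x)))"
        by (rule has_density_of_represents[OF nonneg])
      then show "has_density \<mu> (\<lambda>x. if x \<in> {gm..gp} then 2 / (\<beta> * pi) * (x - \<zeta>) * sqrt ((x - gm) * (gp - x)) else 0)"
        unfolding Im_R by (simp only: if_distrib[of "(*) _"] mult_zero_right mult.assoc)
    qed (rule \<zeta>(5))
    note props = this
    have supercritical: "(\<forall>z. cubic \<beta> a z = 0 \<longrightarrow> z \<in> \<real>) \<and>
       (\<exists>\<zeta>::real. cubic \<beta> a (of_real \<zeta>) = 0 \<and>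
          (\<forall>x::real. cubic \<beta> a (of_real x) = 0 \<longrightarrow> \<zeta> \<le> x) \<and>
          (let \<gamma>m = - \<zeta> - sqrt (2 * (a - \<zeta>\<^sup>2));
               \<gamma>p = - \<zeta> + sqrt (2 * (a - \<zeta>\<^sup>2));
               \<rho> = (\<lambda>x. if x \<in> {\<gamma>m..\<gamma>p}
                        then 2 / (\<beta> * pi) * (x - \<zeta>) * sqrt ((x - \<gamma>m) * (\<gamma>p - x)) else 0)
           in \<zeta>\<^sup>2 \<le> a \<and> (\<forall>\<mu>. represents \<mu> G \<longrightarrow> has_density \<mu> \<rho>)))"
      by (intro exI[of _ \<zeta>] conjI root allI impI all_real minimal, assumption, assumption)
         (unfold Let_def d_def[symmetric] g[symmetric], rule props)
    have vacuous: "a < a_star \<beta> \<longrightarrow> Q" for Q using True by simp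
    show ?thesis
      by (rule exI[of _ G], rule conjunction, rule exists_unique_stationary, rule nonneg, rule flux_value,
          rule impI, rule supercritical, rule vacuous)
  next
    case False
    then have a: "a < a_star \<beta>" by simp
    obtain \<xi> \<eta> :: real where \<xi>\<eta>: "\<xi> < 0" "\<eta> > 0" and \<beta>_eq: "\<beta> = - 8 * \<xi> * (\<xi>\<^sup>2 + \<eta>\<^sup>2)" and a_eq: "a = 3 * \<xi>\<^sup>2 - \<eta>\<^sup>2"
      using subcritical_root[OF \<beta> a] .
    define \<zeta> where "\<zeta> = Complex \<xi> \<eta>"
    define s where "s = csqrt (4 * of_real \<xi> * cnj \<zeta>)"
    define J where "J = \<zeta> - 1 / of_real \<beta> * (\<zeta>\<^sup>2 - of_real a)\<^sup>2"
    \<comment> \<open>This identity makes \<open>p\<close>, \<open>q\<close> and \<open>J\<close> explicit in terms of \<open>\<xi>\<close> and \<open>\<eta>\<close>.\<close>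
    have sq: "\<zeta>\<^sup>2 - of_real a = - 2 * of_real \<xi> * cnj \<zeta>"
      by (simp add: \<zeta>_def a_eq complex_eq_iff power2_eq_square)
    have \<zeta>H: "\<zeta> \<in> upper_half_plane" using \<xi>\<eta> by (simp add: \<zeta>_def upper_half_plane_def)
    have factor3: "cubic \<beta> a z = 4 * (z - \<zeta>) * (z - cnj \<zeta>) * (z + 2 * of_real \<xi>)" for z
    proof -
      have "\<zeta> + cnj \<zeta> = 2 * of_real \<xi>" "\<zeta> * cnj \<zeta> = of_real (\<xi>\<^sup>2 + \<eta>\<^sup>2)"
        by (simp_all add: \<zeta>_def complex_eq_iff power2_eq_square)
      moreover have "(z - \<zeta>) * (z - cnj \<zeta>) = z\<^sup>2 - (\<zeta> + cnj \<zeta>) * z + \<zeta> * cnj \<zeta>"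
        by (simp add: power2_eq_square algebra_simps)
      ultimately have quad: "(z - \<zeta>) * (z - cnj \<zeta>) = z\<^sup>2 - 2 * of_real \<xi> * z + of_real (\<xi>\<^sup>2 + \<eta>\<^sup>2)"
        by simp
      show ?thesis
        unfolding mult.assoc[of 4] quad cubic_def \<beta>_eq a_eq
        by (simp add: power2_eq_square power3_eq_cube algebra_simps)
    qed
    have root: "cubic \<beta> a \<zeta> = 0" by (simp add: factor3)
    have unique_root: "w = \<zeta>" if "w \<in> upper_half_plane" "cubic \<beta> a w = 0" for w
    proof -
      have "w - cnj \<zeta> \<noteq> 0" "w + 2 * of_real \<xi> \<noteq> 0"
        using that(1) \<xi>\<eta> by (auto simp: upper_half_plane_def \<zeta>_def complex_eq_iff)
      then show ?thesis using that(2) by (simp add: factor3)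
    qed
    have s_sq: "s\<^sup>2 = 4 * of_real \<xi> * cnj \<zeta>" by (simp add: s_def)
    have s_Im: "\<bar>Im s\<bar> \<le> \<eta>"
      using subcritical_lower_half_plane[OF \<xi>\<eta>(2), of s \<xi>] s_sq by (simp add: \<zeta>_def complex_cnj)
    interpret stationary_curve \<beta> a \<zeta> "- \<zeta> + s" "- \<zeta> - s" J
    proof
      have "s\<^sup>2 = - 2 * (\<zeta>\<^sup>2 - of_real a)" unfolding sq s_sq by simp
      then have "s\<^sup>2 = 2 * (of_real a - \<zeta>\<^sup>2)" by simp
      then show "(z - \<zeta>)\<^sup>2 * ((z - (- \<zeta> + s)) * (z - (- \<zeta> - s))) = (z\<^sup>2 - of_real a)\<^sup>2 - of_real \<beta> * (z - J)" for z
        using \<beta> by (intro double_root_factorization root J_def) auto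
    qed (use \<beta> s_Im in \<open>auto simp: \<zeta>_def\<close>)
    define n where "n = \<xi>\<^sup>2 + \<eta>\<^sup>2"
    have n: "n > 0" using \<xi>\<eta> by (simp add: n_def add_pos_pos)
    have "Im J = \<eta> ^ 3 / n"
    proof -
      have "J = \<zeta> + of_real (\<xi> / (2 * n)) * (cnj \<zeta>)\<^sup>2"
      proof -
        have "1 / of_real \<beta> * (- 2 * of_real \<xi> * cnj \<zeta>)\<^sup>2 = of_real (4 * \<xi>\<^sup>2 / \<beta>) * (cnj \<zeta>)\<^sup>2"
          by (simp add: power_mult_distrib)
        also have "4 * \<xi>\<^sup>2 / \<beta> = - (\<xi> / (2 * n))"
          using \<xi>\<eta> n unfolding \<beta>_eq n_def[symmetric] by (simp add: power2_eq_square)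
        finally show ?thesis unfolding J_def sq by simp
      qed
      then have "Im J = \<eta> - \<xi> / (2 * n) * (2 * \<xi> * \<eta>)"
        by (simp add: \<zeta>_def power2_eq_square)
      also have "\<dots> = \<eta> * (n - \<xi>\<^sup>2) / n" using n by (simp add: power2_eq_square field_simps)
      finally show ?thesis by (simp add: n_def power2_eq_square power3_eq_cube)
    qed
    then have J_pos: "Im J > 0" using \<xi>\<eta> n by simp
    note pos = Im_R_pos[OF J_pos]
    have nonneg: "Im (R (of_real x)) \<ge> 0" for x using pos by (simp add: less_imp_le)
    have flux_value: "\<forall>F K. normalized_pick F \<and> (\<forall>z\<in>upper_half_plane. flux \<beta> a F z = K) \<longrightarrow> K = J"
    proof (intro allI impI, elim conjE)
      fix F K
      assume F: "normalized_pick F" "\<forall>z\<in>upper_half_plane. flux \<beta> a F z = K"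
      have "\<not> (\<exists>r::real. r < 0 \<and> cubic \<beta> a (of_real r) = 0)"
        using a_star_le_of_negative_root[OF \<beta>] a by (auto simp only: cubic_of_real_eq_0_iff not_le[symmetric])
      then obtain w where w: "w \<in> upper_half_plane" "cubic \<beta> a w = 0"
          "(w\<^sup>2 - of_real a)\<^sup>2 = of_real \<beta> * (w - K)"
        using stationary_constant[OF \<beta> F(1), of a K] F(2) by blast
      then show "K = J" using unique_root[OF w(1,2)] \<beta> by (simp add: J_def)
    qed
    define \<rho> where "\<rho> = (\<lambda>x::real. 2 / (\<beta> * pi) * Im (R (of_real x)))"
    \<comment> \<open>Both are the square root of \<open>P(x)\<close> with positive imaginary part.\<close>
    have \<rho>_eq: "2 / (\<beta> * pi) * Im (upper_csqrt (((of_real x)\<^sup>2 - of_real a)\<^sup>2 - of_real \<beta> * (of_real x - J))) = \<rho> x" for x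
      using upper_csqrt_eqI[OF R_square pos] by (simp add: \<rho>_def)
    have "\<rho> x \<noteq> 0" for x using pos[of x] \<beta> by (simp add: \<rho>_def)
    then have support: "closure {x. \<rho> x \<noteq> 0} = UNIV" by simp
    have "\<rho> \<sim>[at_top] (\<lambda>x. (1 / pi * Im J) / x\<^sup>2)" "\<rho> \<sim>[at_bot] (\<lambda>x. (1 / pi * Im J) / x\<^sup>2)"
      using density_asymp J_pos unfolding \<rho>_def
      by (intro asymp_equiv_inverse_square; simp)+
    moreover have "\<forall>\<mu>. represents \<mu> G \<longrightarrow> has_density \<mu> \<rho>"
      using has_density_of_represents[OF nonneg] by (simp add: \<rho>_def)
    ultimately have props: "(\<forall>\<mu>. represents \<mu> G \<longrightarrow> has_density \<mu> \<rho>) \<and> closure {x. \<rho> x \<noteq> 0} = UNIV \<and>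
        1 / pi * Im J > 0 \<and> \<rho> \<sim>[at_top] (\<lambda>x. (1 / pi * Im J) / x\<^sup>2) \<and> \<rho> \<sim>[at_bot] (\<lambda>x. (1 / pi * Im J) / x\<^sup>2)"
      using support J_pos by simp
    have subcritical: "\<exists>\<zeta>::complex. \<zeta> \<in> upper_half_plane \<and> cubic \<beta> a \<zeta> = 0 \<and>
          (\<forall>w\<in>upper_half_plane. cubic \<beta> a w = 0 \<longrightarrow> w = \<zeta>) \<and>
          (let J = \<zeta> - 1 / of_real \<beta> * (\<zeta>\<^sup>2 - of_real a)\<^sup>2;
               P = (\<lambda>z::complex. (z\<^sup>2 - of_real a)\<^sup>2 - of_real \<beta> * (z - J));
               \<rho> = (\<lambda>x::real. 2 / (\<beta> * pi) * Im (upper_csqrt (P (of_real x))));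
               C = 1 / pi * Im J
           in (\<forall>\<mu>. represents \<mu> G \<longrightarrow> has_density \<mu> \<rho>) \<and>
              closure {x. \<rho> x \<noteq> 0} = UNIV \<and>
              C > 0 \<and>
              \<rho> \<sim>[at_top] (\<lambda>x. C / x\<^sup>2) \<and>
              \<rho> \<sim>[at_bot] (\<lambda>x. C / x\<^sup>2))"
      by (intro exI[of _ \<zeta>] conjI \<zeta>H root ballI impI unique_root, assumption, assumption)
         (unfold Let_def J_def[symmetric] \<rho>_eq, rule props)
    have vacuous: "a \<ge> a_star \<beta> \<longrightarrow> Q" for Q using False by simp
    show ?thesis
      by (rule exI[of _ G], rule conjunction, rule exists_unique_stationary, rule nonneg, rule flux_value,
          rule vacuous, rule impI, rule subcritical)
  qed
qed

end
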